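(* Let $H$ be a subspace of $c_0$ such that $c_0/H$ is not isomorphic to $c_0$. Then the Bourgain–Pisier space $\mathcal{L}_\infty(H)$ is not an $\mathscr{LP}$ space.
   Context: Operators are bounded linear maps and subspaces are closed. For a separable Banach space $X$, the Bourgain–Pisier construction provides an exact sequence of Banach spaces $0\to X\to \mathcal{L}_\infty(X)\to \mathcal{L}_\infty(X)/X\to 0$ (so that $X$ is a closed subspace of $\mathcal{L}_\infty(X)$) in which $\mathcal{L}_\infty(X)$ is a separable $\mathcal{L}_\infty$-space and $\mathcal{L}_\infty(X)/X$ has the Schur property (weakly convergent sequences are norm convergent). Here $\mathcal{L}_\infty(H)$ denotes the middle space of such a sequence with $X=H$. A Banach space $E$ is an $\mathcal{L}_\infty$-space if there is $\mu\ge 1$ such that every finite-dimensional subspace of $E$ is contained in a finite-dimensional subspace $G$ of $E$ with Banach–Mazur distance to $\ell_\infty^{\dim G}$ at most $\mu$. A Banach space $E$ is an $\mathscr{LP}$ (Lindenstrauss–Pełczyński) space if every operator from a subspace of $c_0$ into $E$ can be extended to an operator $c_0\to E$.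
   Formalization: The quotient c_0/H is additionally assumed to be infinite-dimensional; without this the claim fails, e.g. for H = c_0 with middle space c_0 and zero quotient, where c_0/H = 0 is not isomorphic to c_0 but c_0 is an LP space by Sobczyk's theorem. *)

theory Defs
  imports "HOL-Analysis.Analysis"
begin

subsection \<open>The Banach space of null sequences\<close>

text \<open>The space \<open>c0\<close> of real null sequences is carved out of the bounded (automatically continuous)
  functions on the discrete space \<^typ>\<open>nat\<close>, from which it inherits the supremum norm.\<close>

typedef c0 = "{f :: nat \<Rightarrow>\<^sub>C real. apply_bcontfun f \<longlonglongrightarrow> 0}"
  morphisms bcf_of_c0 c0_of_bcf
  by (rule exI[of _ 0]) simp

lemma bcf_of_c0_tendsto: "apply_bcontfun (bcf_of_c0 x) \<longlonglongrightarrow> 0"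
  using bcf_of_c0[of x] by simp

instantiation c0 :: real_vector
begin

definition "0 = c0_of_bcf 0"
definition "x + y = c0_of_bcf (bcf_of_c0 x + bcf_of_c0 y)"
definition "x - y = c0_of_bcf (bcf_of_c0 x - bcf_of_c0 y)"
definition "- x = c0_of_bcf (- bcf_of_c0 x)"
definition "r *\<^sub>R x = c0_of_bcf (r *\<^sub>R bcf_of_c0 x)"

lemma bcf_of_c0_ops:
  "bcf_of_c0 0 = 0"
  "bcf_of_c0 (x + y) = bcf_of_c0 x + bcf_of_c0 y"
  "bcf_of_c0 (x - y) = bcf_of_c0 x - bcf_of_c0 y"
  "bcf_of_c0 (- x) = - bcf_of_c0 x"
  "bcf_of_c0 (r *\<^sub>R x) = r *\<^sub>R bcf_of_c0 x"
proof -
  have "(\<lambda>n. bcf_of_c0 x n + bcf_of_c0 y n) \<longlonglongrightarrow> 0" "(\<lambda>n. bcf_of_c0 x n - bcf_of_c0 y n) \<longlonglongrightarrow> 0"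
    "(\<lambda>n. - bcf_of_c0 x n) \<longlonglongrightarrow> 0" "(\<lambda>n. r * bcf_of_c0 x n) \<longlonglongrightarrow> 0"
    using tendsto_add[OF bcf_of_c0_tendsto[of x] bcf_of_c0_tendsto[of y]]
      tendsto_diff[OF bcf_of_c0_tendsto[of x] bcf_of_c0_tendsto[of y]]
      tendsto_minus[OF bcf_of_c0_tendsto[of x]]
      tendsto_mult_left[OF bcf_of_c0_tendsto[of x], of r] by simp_all
  then show
    "bcf_of_c0 0 = 0"
    "bcf_of_c0 (x + y) = bcf_of_c0 x + bcf_of_c0 y"
    "bcf_of_c0 (x - y) = bcf_of_c0 x - bcf_of_c0 y"
    "bcf_of_c0 (- x) = - bcf_of_c0 x"
    "bcf_of_c0 (r *\<^sub>R x) = r *\<^sub>R bcf_of_c0 x"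
    by (simp_all add: zero_c0_def plus_c0_def minus_c0_def uminus_c0_def scaleR_c0_def
        c0_of_bcf_inverse)
qed

instance
  by standard (simp_all only: bcf_of_c0_inject[symmetric] bcf_of_c0_ops algebra_simps scaleR_one right_minus add_0_left scaleR_scaleR)

end

instantiation c0 :: real_normed_vector
begin

definition "norm x = norm (bcf_of_c0 x)"
definition "dist x y = dist (bcf_of_c0 x) (bcf_of_c0 y)"
definition "sgn (x :: c0) = x /\<^sub>R norm x"
definition uniformity_c0 :: "(c0 \<times> c0) filter"
  where "uniformity_c0 = (INF e\<in>{0 <..}. principal {(x, y). dist x y < e})"
definition open_c0 :: "c0 set \<Rightarrow> bool"
  where "open_c0 S = (\<forall>x\<in>S. \<forall>\<^sub>F (x', y) in uniformity. x' = x \<longrightarrow> y \<in> S)"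

instance
proof
  fix x y :: c0 and a :: real
  show "dist x y = norm (x - y)"
    by (simp add: dist_c0_def norm_c0_def bcf_of_c0_ops dist_norm)
  show "norm (x + y) \<le> norm x + norm y"
    by (simp add: norm_c0_def bcf_of_c0_ops norm_triangle_ineq)
  show "norm x = 0 \<longleftrightarrow> x = 0"
    by (simp add: norm_c0_def bcf_of_c0_inject[symmetric, of x 0] bcf_of_c0_ops)
  show "norm (a *\<^sub>R x) = \<bar>a\<bar> * norm x"
    by (simp add: norm_c0_def bcf_of_c0_ops)
qed (rule sgn_c0_def uniformity_c0_def open_c0_def)+

end

instance c0 :: banach
proof
  fix X :: "nat \<Rightarrow> c0"
  assume "Cauchy X"
  then have "Cauchy (\<lambda>n. bcf_of_c0 (X n))"
    by (simp add: Cauchy_def dist_c0_def)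
  then have "uniformly_Cauchy_on UNIV (\<lambda>n. apply_bcontfun (bcf_of_c0 (X n)))"
    unfolding Cauchy_def uniformly_Cauchy_on_def
    by (meson UNIV_I dist_fun_lt_imp_dist_val_lt)
  then obtain g where "uniform_limit UNIV (\<lambda>n. apply_bcontfun (bcf_of_c0 (X n))) g sequentially"
    using Cauchy_uniformly_convergent unfolding uniformly_convergent_on_def by blast
  then obtain l where l: "(\<lambda>n. bcf_of_c0 (X n)) \<longlonglongrightarrow> l"
    by (rule uniform_limit_bcontfunE) simp
  have "apply_bcontfun l \<longlonglongrightarrow> 0"
  proof (rule tendstoI)
    fix e :: real
    assume "0 < e"
    then have "\<forall>\<^sub>F n in sequentially. dist (bcf_of_c0 (X n)) l < e / 2"
      using tendstoD[OF l, of "e / 2"] by simp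
    then obtain n where n: "dist (bcf_of_c0 (X n)) l < e / 2"
      by (auto simp: eventually_sequentially)
    have "\<forall>\<^sub>F k in sequentially. dist (bcf_of_c0 (X n) k) 0 < e / 2"
      using tendstoD[OF bcf_of_c0_tendsto, of "e / 2"] \<open>0 < e\<close> by simp
    then show "\<forall>\<^sub>F k in sequentially. dist (l k) 0 < e"
    proof eventually_elim
      case (elim k)
      have "dist (bcf_of_c0 (X n) k) (l k) < e / 2"
        by (rule dist_fun_lt_imp_dist_val_lt[OF n])
      with elim show ?case
        using dist_triangle_half_r[of "bcf_of_c0 (X n) k" "l k" e 0] by simp
    qed
  qed
  then have "bcf_of_c0 (c0_of_bcf l) = l"
    by (simp add: c0_of_bcf_inverse)
  then have "X \<longlonglongrightarrow> c0_of_bcf l"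
    using l by (simp add: lim_sequentially dist_c0_def)
  then show "convergent X"
    by (auto simp: convergent_def)
qed

definition c0_nth :: "c0 \<Rightarrow> nat \<Rightarrow> real" where
  "c0_nth x n = apply_bcontfun (bcf_of_c0 x) n"

lemma norm_c0_eq_SUP: "norm (x :: c0) = (SUP n. \<bar>c0_nth x n\<bar>)"
  by (simp add: norm_c0_def norm_bcontfun_def dist_bcontfun.rep_eq c0_nth_def)


subsection \<open>Operators between subspaces\<close>

definition operator_on ::
    "'a::real_normed_vector set \<Rightarrow> ('a \<Rightarrow> 'b::real_normed_vector) \<Rightarrow> bool" where
  "operator_on S T \<longleftrightarrow>
     (\<forall>x\<in>S. \<forall>y\<in>S. T (x + y) = T x + T y) \<and>
     (\<forall>r. \<forall>x\<in>S. T (r *\<^sub>R x) = r *\<^sub>R T x) \<and>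
     (\<exists>K. \<forall>x\<in>S. norm (T x) \<le> K * norm x)"

definition opnorm_on ::
    "'a::real_normed_vector set \<Rightarrow> ('a \<Rightarrow> 'b::real_normed_vector) \<Rightarrow> real" where
  "opnorm_on S T = Inf {K. 0 \<le> K \<and> (\<forall>x\<in>S. norm (T x) \<le> K * norm x)}"

definition isomorphism_on ::
    "'a::real_normed_vector set \<Rightarrow> 'b::real_normed_vector set \<Rightarrow> ('a \<Rightarrow> 'b) \<Rightarrow> bool" where
  "isomorphism_on S R T \<longleftrightarrow>
     operator_on S T \<and> bij_betw T S R \<and> operator_on R (inv_into S T)"

definition embedding_on ::
    "'a::real_normed_vector set \<Rightarrow> ('a \<Rightarrow> 'b::real_normed_vector) \<Rightarrow> bool" where
  "embedding_on S T \<longleftrightarrow> isomorphism_on S (T ` S) T"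


subsection \<open>\<open>\<L>\<^sub>\<infinity>\<close>-spaces and Lindenstrauss--Pelczynski spaces\<close>

text \<open>The infimum is taken in the extended reals, so that it is infinite for non-isomorphic
  subspaces.\<close>

definition banach_mazur_distance ::
    "'a::real_normed_vector set \<Rightarrow> 'b::real_normed_vector set \<Rightarrow> ereal" where
  "banach_mazur_distance S R =
     Inf {ereal (opnorm_on S T * opnorm_on R (inv_into S T)) | T. isomorphism_on S R T}"

text \<open>The space of \<open>n\<close>-tuples with the maximum norm, as the sequences supported in \<open>{..<n}\<close>.\<close>

definition ell_infinity :: "nat \<Rightarrow> c0 set" where
  "ell_infinity n = {x. \<forall>i\<ge>n. c0_nth x i = 0}"

definition fin_dim_subspace :: "'a::real_vector set \<Rightarrow> bool" where
  "fin_dim_subspace S \<longleftrightarrow> (\<exists>B. finite B \<and> S = span B)"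

definition L_infinity_space :: "'e::banach itself \<Rightarrow> bool" where
  "L_infinity_space _ \<longleftrightarrow>
     (\<exists>\<mu>\<ge>1. \<forall>F :: 'e set. fin_dim_subspace F \<longrightarrow>
        (\<exists>G. fin_dim_subspace G \<and> F \<subseteq> G \<and>
             banach_mazur_distance G (ell_infinity (dim G)) \<le> ereal \<mu>))"

definition LP_space :: "'e::banach itself \<Rightarrow> bool" where
  "LP_space _ \<longleftrightarrow>
     (\<forall>(Y :: c0 set) (t :: c0 \<Rightarrow> 'e).
        subspace Y \<and> closed Y \<and> operator_on Y t \<longrightarrow>
        (\<exists>T. bounded_linear T \<and> (\<forall>y\<in>Y. T y = t y)))"


subsection \<open>Quotients\<close>

text \<open>The quotient of the ambient space by a closed subspace \<open>M\<close> consists of the cosets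
  \<open>coset M x\<close>; its vector space operations are \<open>coset M x + coset M y = coset M (x + y)\<close> and
  \<open>r * coset M x = coset M (r * x)\<close>. As \<open>M\<close> is a term, the quotient cannot be made a type,
  and the notions below are spelled out on cosets.\<close>

definition coset :: "'a::real_vector set \<Rightarrow> 'a \<Rightarrow> 'a set" where
  "coset M x = (+) x ` M"

definition quotient_norm :: "'a::real_normed_vector set \<Rightarrow> real" where
  "quotient_norm A = (INF a\<in>A. norm a)"

definition quotient_operator ::
    "'a::real_normed_vector set \<Rightarrow> ('a set \<Rightarrow> 'b::real_normed_vector) \<Rightarrow> bool" where
  "quotient_operator M T \<longleftrightarrow>
     (\<forall>x y. T (coset M (x + y)) = T (coset M x) + T (coset M y)) \<and>
     (\<forall>r x. T (coset M (r *\<^sub>R x)) = r *\<^sub>R T (coset M x)) \<and>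
     (\<exists>K. \<forall>x. norm (T (coset M x)) \<le> K * quotient_norm (coset M x))"

definition quotient_isomorphic ::
    "'a::real_normed_vector set \<Rightarrow> 'b::real_normed_vector itself \<Rightarrow> bool" where
  "quotient_isomorphic M _ \<longleftrightarrow>
     (\<exists>T :: 'a set \<Rightarrow> 'b. quotient_operator M T \<and> bij_betw T (range (coset M)) UNIV \<and>
        (\<exists>K. \<forall>x. quotient_norm (coset M x) \<le> K * norm (T (coset M x))))"

definition quotient_finite_dim :: "'a::real_vector set \<Rightarrow> bool" where
  "quotient_finite_dim M \<longleftrightarrow>
     (\<exists>F. finite F \<and> range (coset M) = coset M ` span F)"

text \<open>The quotient by \<open>M\<close> has the Schur property; a sequence in the quotient is given by
  representatives \<open>x n\<close>, and its weak limit by a representative \<open>l\<close>.\<close>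

definition quotient_schur :: "'a::real_normed_vector set \<Rightarrow> bool" where
  "quotient_schur M \<longleftrightarrow>
     (\<forall>(x :: nat \<Rightarrow> 'a) l.
        (\<forall>\<phi> :: 'a set \<Rightarrow> real. quotient_operator M \<phi> \<longrightarrow>
           (\<lambda>n. \<phi> (coset M (x n))) \<longlonglongrightarrow> \<phi> (coset M l)) \<longrightarrow>
        (\<lambda>n. quotient_norm (coset M (x n - l))) \<longlonglongrightarrow> 0)"


subsection \<open>Bourgain--Pisier extensions\<close>

text \<open>\<open>bourgain_pisier X j\<close>: the type \<^typ>\<open>'e\<close> is the middle space of a Bourgain--Pisier exact
  sequence starting with \<open>X\<close>, where \<open>j\<close> embeds \<open>X\<close> as a closed subspace of it. The embedding
  need not be isometric.\<close>

definition bourgain_pisier ::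
    "'a::real_normed_vector set \<Rightarrow> ('a \<Rightarrow> 'e::banach) \<Rightarrow> bool" where
  "bourgain_pisier X j \<longleftrightarrow>
     embedding_on X j \<and>
     separable_space (euclidean :: 'e topology) \<and>
     L_infinity_space TYPE('e) \<and>
     quotient_schur (j ` X)"

end

theory Submission
  imports Defs "HOL-Complex_Analysis.Great_Picard"
begin

text \<open>The argument is by contradiction. Let \<open>E\<close> be the middle space and suppose that it is a
  Lindenstrauss--Pelczynski space. Then the embedding \<open>j\<close> of \<open>H\<close> extends to an operator
  \<open>T : c0 \<rightarrow> E\<close>. On the other hand, \<open>E\<close> is separable, so by Sobczyk's theorem (\<open>sobczyk\<close>) the inverse
  of \<open>j\<close>, as an operator from \<open>j ` H\<close> into \<open>c0\<close>, extends to an operator \<open>A : E \<rightarrow> c0\<close>. The operator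
  \<open>U = A \<circ> T\<close> on \<open>c0\<close> is the identity on \<open>H\<close>.

  Tails of a bounded sequence of null sequences form a weakly null sequence, and the quotient
  \<open>E / j ` H\<close> has the Schur property. Therefore \<open>T\<close> is uniformly small on tails modulo \<open>j ` H\<close>
  (\<open>schur_quotient_small_on_tails\<close>), and \<open>U\<close> is uniformly small on tails modulo \<open>H\<close>. In other words,
  \<open>U\<close> induces a compact operator \<open>W\<close> on \<open>c0 / H\<close>.

  The operator \<open>P = 1 - U\<close> annihilates \<open>H\<close> and induces \<open>1 - W\<close>; so \<open>1 - W\<close> factors through \<open>c0\<close>, and
  by the theory of Riesz it is an isomorphism up to finite dimensions. This makes the range of \<open>P\<close>,
  up to finite dimensions, a complement of \<open>H\<close> in \<open>c0\<close> (\<open>complemented_if_small_on_tails\<close>). The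
  proof takes place in \<open>c0\<close>, with the distance to \<open>H\<close> in place of the norm of the quotient.

  Consequently \<open>c0 / H\<close> is isomorphic to a complemented subspace of \<open>c0\<close>. By Pelczynski's theorem
  (\<open>complemented_subspace_isomorphic_c0\<close>) such a subspace is finite-dimensional or isomorphic to
  \<open>c0\<close>, which contradicts the hypotheses on \<open>H\<close>.\<close>


section \<open>Coordinates in the space of null sequences\<close>

lemma c0_nth_tendsto_0: "c0_nth x \<longlonglongrightarrow> 0"
  using bcf_of_c0_tendsto[of x] by (simp add: c0_nth_def[abs_def])

lemma c0_nth_ops [simp]:
  "c0_nth 0 n = 0"
  "c0_nth (x + y) n = c0_nth x n + c0_nth y n"
  "c0_nth (x - y) n = c0_nth x n - c0_nth y n"
  "c0_nth (- x) n = - c0_nth x n"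
  "c0_nth (r *\<^sub>R x) n = r * c0_nth x n"
  by (simp_all add: c0_nth_def bcf_of_c0_ops)

lemma c0_eqI: "(\<And>n. c0_nth x n = c0_nth y n) \<Longrightarrow> x = y"
  by (metis apply_bcontfun_inject bcf_of_c0_inject c0_nth_def ext)

lemma abs_c0_nth_le_norm: "\<bar>c0_nth x n\<bar> \<le> norm x"
proof -
  have "dist (apply_bcontfun (bcf_of_c0 x) n) (apply_bcontfun 0 n) \<le> dist (bcf_of_c0 x) 0"
    by (rule dist_bounded)
  then show ?thesis
    by (simp add: c0_nth_def norm_c0_def)
qed

lemma norm_c0_le: "(\<And>n. \<bar>c0_nth x n\<bar> \<le> C) \<Longrightarrow> norm x \<le> C"
  unfolding norm_c0_eq_SUP by (rule cSUP_least) auto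

lemma bounded_linear_c0_nth: "bounded_linear (\<lambda>x. c0_nth x n)"
  by (rule bounded_linear_intro[of _ 1]) (auto simp: abs_c0_nth_le_norm)

lemmas c0_nth_sum = linear_sum[OF bounded_linear.linear[OF bounded_linear_c0_nth]]

definition c0_of :: "(nat \<Rightarrow> real) \<Rightarrow> c0" where
  "c0_of f = c0_of_bcf (Bcontfun f)"

lemma c0_nth_c0_of:
  assumes "f \<longlonglongrightarrow> 0"
  shows "c0_nth (c0_of f) n = f n"
proof -
  have "bounded (range f)"
    using assms convergent_imp_bounded by blast
  then have "f \<in> bcontfun"
    by (simp add: bcontfun_def)
  then show ?thesis
    using assms by (simp add: c0_nth_def c0_of_def c0_of_bcf_inverse Bcontfun_inverse)
qed

lemma bounded_linear_c0_ofI: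
  fixes f :: "'a::real_normed_vector \<Rightarrow> nat \<Rightarrow> real"
  assumes lim: "\<And>x. f x \<longlonglongrightarrow> 0"
    and add: "\<And>x y n. f (x + y) n = f x n + f y n"
    and scale: "\<And>r x n. f (r *\<^sub>R x) n = r * f x n"
    and bound: "\<And>x n. \<bar>f x n\<bar> \<le> K * norm x"
  shows "bounded_linear (\<lambda>x. c0_of (f x))"
proof (rule bounded_linear_intro[of _ K])
  show "norm (c0_of (f x)) \<le> norm x * K" for x
    using bound by (intro norm_c0_le) (simp add: c0_nth_c0_of lim mult.commute)
qed (auto intro!: c0_eqI simp: c0_nth_c0_of lim add scale)

definition c0_unit :: "nat \<Rightarrow> c0" where
  "c0_unit k = c0_of (\<lambda>i. if i = k then 1 else 0)"

lemma c0_nth_unit [simp]: "c0_nth (c0_unit k) i = (if i = k then 1 else 0)"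
proof -
  have "(\<lambda>i. if i = k then 1 else 0::real) \<longlonglongrightarrow> 0"
    by (rule tendsto_eventually) (auto simp: eventually_sequentially intro!: exI[of _ "Suc k"])
  then show ?thesis
    by (simp add: c0_unit_def c0_nth_c0_of)
qed

definition c0_tail :: "nat \<Rightarrow> c0 \<Rightarrow> c0" where
  "c0_tail N x = c0_of (\<lambda>i. if i < N then 0 else c0_nth x i)"

lemma tail_seq_tendsto_0: "(\<lambda>i. if i < N then 0 else c0_nth x i) \<longlonglongrightarrow> 0"
proof (rule Lim_transform_eventually[OF c0_nth_tendsto_0[of x]])
  show "\<forall>\<^sub>F i in sequentially. c0_nth x i = (if i < N then 0 else c0_nth x i)"
    by (auto simp: eventually_sequentially intro!: exI[of _ N])
qed

lemma c0_nth_tail [simp]: "c0_nth (c0_tail N x) i = (if i < N then 0 else c0_nth x i)"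
  by (simp add: c0_tail_def c0_nth_c0_of tail_seq_tendsto_0)

lemma bounded_linear_c0_tail: "bounded_linear (c0_tail N)"
  unfolding c0_tail_def[abs_def]
  by (rule bounded_linear_c0_ofI[of _ 1]) (auto simp: tail_seq_tendsto_0 abs_c0_nth_le_norm)

lemma c0_head_eq_sum: "x - c0_tail N x = (\<Sum>i<N. c0_nth x i *\<^sub>R c0_unit i)"
proof (rule c0_eqI)
  fix n
  have "(\<Sum>i<N. c0_nth x i * (if n = i then 1 else 0)) = (\<Sum>i<N. if n = i then c0_nth x i else 0)"
    by (rule sum.cong) auto
  then show "c0_nth (x - c0_tail N x) n = c0_nth (\<Sum>i<N. c0_nth x i *\<^sub>R c0_unit i) n"
    by (simp add: c0_nth_sum sum.delta)
qed

lemma c0_tail_tendsto_0: "(\<lambda>N. c0_tail N x) \<longlonglongrightarrow> 0"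
proof (rule LIMSEQ_I)
  fix e :: real assume "0 < e"
  then obtain M where M: "\<And>n. n \<ge> M \<Longrightarrow> \<bar>c0_nth x n\<bar> < e / 2"
    using LIMSEQ_D[OF c0_nth_tendsto_0[of x], of "e/2"] by auto
  have "norm (c0_tail N x - 0) < e" if "N \<ge> M" for N
  proof -
    have "norm (c0_tail N x) \<le> e / 2"
      using M that \<open>0 < e\<close> by (intro norm_c0_le) (auto intro: less_imp_le)
    then show ?thesis using \<open>0 < e\<close> by simp
  qed
  then show "\<exists>M. \<forall>N\<ge>M. norm (c0_tail N x - 0) < e" by blast
qed

text \<open>The values of a functional at the unit vectors are absolutely summable, because finitely
  many unit vectors, with signs, add up to a vector of norm at most one. So functionals are small on
  tails: this is \<open>c0\<^sup>* = \<ell>\<^sub>1\<close>.\<close>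

lemma c0_functional_small_on_tail:
  fixes g :: "c0 \<Rightarrow> real"
  assumes g: "bounded_linear g" and "0 < e"
  shows "\<exists>N. \<forall>n\<ge>N. \<forall>x. \<bar>g (c0_tail n x)\<bar> \<le> e * norm x"
proof -
  interpret g: bounded_linear g by (rule g)
  obtain K where K: "\<And>x. \<bar>g x\<bar> \<le> norm x * K"
    using g.nonneg_bounded by auto
  define a where "a i = \<bar>g (c0_unit i)\<bar>" for i
  have "(\<Sum>i<n. a i) \<le> \<bar>K\<bar>" for n
  proof -
    define s where "s = (\<Sum>i<n. sgn (g (c0_unit i)) *\<^sub>R c0_unit i)"
    have "norm s \<le> 1"
    proof (rule norm_c0_le)
      fix k
      have "c0_nth s k = (\<Sum>i<n. if k = i then sgn (g (c0_unit i)) else 0)"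
        unfolding s_def c0_nth_sum by (rule sum.cong) auto
      then show "\<bar>c0_nth s k\<bar> \<le> 1"
        by (simp add: sum.delta abs_sgn_eq)
    qed
    have "(\<Sum>i<n. a i) = g s"
      by (simp add: s_def a_def g.sum g.scaleR abs_sgn mult.commute)
    also have "\<dots> \<le> norm s * K" using K[of s] by simp
    also have "\<dots> \<le> norm s * \<bar>K\<bar>" by (intro mult_left_mono) auto
    also have "\<dots> \<le> \<bar>K\<bar>" using \<open>norm s \<le> 1\<close> by (simp add: mult_left_le_one_le)
    finally show ?thesis .
  qed
  then have "summable a"
    by (intro bounded_imp_summable[of _ "\<bar>K\<bar>"]) (auto simp: a_def simp flip: lessThan_Suc_atMost simp del: sum.lessThan_Suc)
  then obtain N where N: "\<And>m n. m \<ge> N \<Longrightarrow> norm (sum a {m..<n}) < e"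
    using \<open>0 < e\<close> unfolding summable_Cauchy by blast
  have "\<bar>g (c0_tail m x)\<bar> \<le> e * norm x" if "m \<ge> N" for m x
  proof -
    have "(\<lambda>n. g (c0_tail m x - c0_tail n (c0_tail m x))) \<longlonglongrightarrow> g (c0_tail m x - 0)"
      by (intro g.tendsto tendsto_intros c0_tail_tendsto_0)
    then have "(\<lambda>n. \<bar>g (c0_tail m x - c0_tail n (c0_tail m x))\<bar>) \<longlonglongrightarrow> \<bar>g (c0_tail m x)\<bar>"
      by (intro tendsto_rabs) simp
    moreover have "\<bar>g (c0_tail m x - c0_tail n (c0_tail m x))\<bar> \<le> e * norm x" for n
    proof -
      have "\<bar>g (c0_tail m x - c0_tail n (c0_tail m x))\<bar>
          = \<bar>\<Sum>i<n. c0_nth (c0_tail m x) i * g (c0_unit i)\<bar>"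
        by (simp only: c0_head_eq_sum g.sum g.scaleR real_scaleR_def)
      also have "\<dots> \<le> (\<Sum>i<n. \<bar>c0_nth (c0_tail m x) i * g (c0_unit i)\<bar>)"
        by (rule sum_abs)
      also have "\<dots> = (\<Sum>i\<in>{m..<n}. \<bar>c0_nth (c0_tail m x) i * g (c0_unit i)\<bar>)"
        by (rule sum.mono_neutral_right) auto
      also have "\<dots> \<le> (\<Sum>i\<in>{m..<n}. norm x * a i)"
        by (intro sum_mono) (auto simp: a_def abs_mult intro!: mult_right_mono abs_c0_nth_le_norm)
      also have "\<dots> = norm x * sum a {m..<n}"
        by (simp add: sum_distrib_left)
      also have "\<dots> \<le> norm x * e"
        using N[OF that, of n] by (intro mult_left_mono) auto
      finally show ?thesis by (simp add: mult.commute)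
    qed
    ultimately show ?thesis
      by (intro LIMSEQ_le_const2) auto
  qed
  then show ?thesis by blast
qed

text \<open>A sequence of vectors whose bounded finite linear combinations are bounded is the image of
  the unit vectors under an operator: coefficients that tend to zero make the series Cauchy.\<close>

lemma c0_synthesis_operator:
  fixes u :: "nat \<Rightarrow> 'a::banach"
  assumes bound: "\<And>c m n M. (\<And>k. \<bar>c k\<bar> \<le> M) \<Longrightarrow> norm (\<Sum>k=m..<n. c k *\<^sub>R u k) \<le> C * M"
  shows "(\<lambda>k. c0_nth x k *\<^sub>R u k) sums (\<Sum>k. c0_nth x k *\<^sub>R u k)"
    and "bounded_linear (\<lambda>x. \<Sum>k. c0_nth x k *\<^sub>R u k)"
proof -
  have C: "0 \<le> C"
    using bound[of "\<lambda>_. 0" 1 0 0] by simp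
  have summable: "summable (\<lambda>k. c0_nth x k *\<^sub>R u k)" for x
    unfolding summable_Cauchy
  proof (intro allI impI)
    fix e :: real assume "0 < e"
    define M where "M = e / (C + 1)"
    have "0 < M" "C * M < e"
      using \<open>0 < e\<close> C by (simp_all add: M_def field_simps)
    then obtain N where N: "\<And>k. k \<ge> N \<Longrightarrow> \<bar>c0_nth x k\<bar> < M"
      using LIMSEQ_D[OF c0_nth_tendsto_0[of x], of M] by auto
    have "norm (\<Sum>k=m..<n. c0_nth x k *\<^sub>R u k) < e" if "m \<ge> N" for m n
    proof -
      have "(\<Sum>k=m..<n. c0_nth x k *\<^sub>R u k) = (\<Sum>k=m..<n. (if m \<le> k then c0_nth x k else 0) *\<^sub>R u k)"
        by (rule sum.cong) auto
      also have "norm \<dots> \<le> C * M"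
        using N that \<open>0 < M\<close> by (intro bound) (auto intro: less_imp_le)
      finally show ?thesis using \<open>C * M < e\<close> by simp
    qed
    then show "\<exists>N. \<forall>m\<ge>N. \<forall>n. norm (\<Sum>k=m..<n. c0_nth x k *\<^sub>R u k) < e" by blast
  qed
  then show "(\<lambda>k. c0_nth x k *\<^sub>R u k) sums (\<Sum>k. c0_nth x k *\<^sub>R u k)"
    by (rule summable_sums)
  show "bounded_linear (\<lambda>x. \<Sum>k. c0_nth x k *\<^sub>R u k)"
  proof (rule bounded_linear_intro[of _ C])
    show "(\<Sum>k. c0_nth (x + y) k *\<^sub>R u k) = (\<Sum>k. c0_nth x k *\<^sub>R u k) + (\<Sum>k. c0_nth y k *\<^sub>R u k)" for x y
      by (simp add: scaleR_left_distrib suminf_add[OF summable summable])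
    show "(\<Sum>k. c0_nth (r *\<^sub>R x) k *\<^sub>R u k) = r *\<^sub>R (\<Sum>k. c0_nth x k *\<^sub>R u k)" for r x
      using suminf_scaleR_right[OF summable[of x], of r] by simp
    show "norm (\<Sum>k. c0_nth x k *\<^sub>R u k) \<le> norm x * C" for x
    proof (rule LIMSEQ_le_const2)
      show "(\<lambda>n. norm (\<Sum>k<n. c0_nth x k *\<^sub>R u k)) \<longlonglongrightarrow> norm (\<Sum>k. c0_nth x k *\<^sub>R u k)"
        using summable_LIMSEQ[OF summable] by (rule tendsto_norm)
      show "\<exists>N. \<forall>n\<ge>N. norm (\<Sum>k<n. c0_nth x k *\<^sub>R u k) \<le> norm x * C"
        using bound[of "c0_nth x" "norm x" 0] abs_c0_nth_le_norm[of x]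
        by (auto simp: atLeast0LessThan mult.commute)
    qed
  qed
qed


section \<open>The Hahn--Banach theorem\<close>

text \<open>Zorn's lemma is applied to subspaces of the product with the real line, standing for graphs of
  dominated extensions. Such a subspace \<open>G\<close> is automatically single-valued: if \<open>(0, r) \<in> G\<close> then
  \<open>r\<close> and \<open>- r\<close> are both at most \<open>p 0 = 0\<close>.\<close>

theorem hahn_banach_sublinear:
  fixes p :: "'a::real_vector \<Rightarrow> real"
  assumes S: "subspace S"
    and add: "\<And>x y. x \<in> S \<Longrightarrow> y \<in> S \<Longrightarrow> f (x + y) = f x + f y"
    and scale: "\<And>r x. x \<in> S \<Longrightarrow> f (r *\<^sub>R x) = r * f x"
    and dom: "\<And>x. x \<in> S \<Longrightarrow> f x \<le> p x"
    and p_add: "\<And>x y. p (x + y) \<le> p x + p y"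
    and p_scale: "\<And>r x. 0 \<le> r \<Longrightarrow> p (r *\<^sub>R x) = r * p x"
  shows "\<exists>g. linear g \<and> (\<forall>x\<in>S. g x = f x) \<and> (\<forall>x. g x \<le> p x)"
proof -
  define \<A> where "\<A> = {G :: ('a \<times> real) set. subspace G \<and> (\<lambda>x. (x, f x)) ` S \<subseteq> G \<and> (\<forall>x r. (x, r) \<in> G \<longrightarrow> r \<le> p x)}"
  have p0: "p 0 = 0" using p_scale[of 0 0] by simp
  have "subspace ((\<lambda>x. (x, f x)) ` S)"
  proof (rule subspaceI)
    show "0 \<in> (\<lambda>x. (x, f x)) ` S"
      using scale[of 0 0] subspace_0[OF S] by (auto simp: zero_prod_def intro!: rev_image_eqI)
    show "x + y \<in> (\<lambda>x. (x, f x)) ` S" if "x \<in> (\<lambda>x. (x, f x)) ` S" "y \<in> (\<lambda>x. (x, f x)) ` S" for x y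
      using that add subspace_add[OF S] by (auto simp: image_iff)
    show "c *\<^sub>R x \<in> (\<lambda>x. (x, f x)) ` S" if "x \<in> (\<lambda>x. (x, f x)) ` S" for c x
      using that scale subspace_scale[OF S] by (auto simp: image_iff)
  qed
  then have "(\<lambda>x. (x, f x)) ` S \<in> \<A>"
    using dom by (auto simp: \<A>_def)
  moreover have "\<Union>C \<in> \<A>" if "C \<noteq> {}" "subset.chain \<A> C" for C
  proof -
    have C: "\<And>G. G \<in> C \<Longrightarrow> G \<in> \<A>" and chain: "\<And>G G'. G \<in> C \<Longrightarrow> G' \<in> C \<Longrightarrow> G \<subseteq> G' \<or> G' \<subseteq> G"
      using that(2) by (auto simp: subset_chain_def)
    have "subspace (\<Union>C)"
    proof (rule subspaceI)
      show "0 \<in> \<Union>C" using that(1) C subspace_0 unfolding \<A>_def by blast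
      show "x + y \<in> \<Union>C" if xy: "x \<in> \<Union>C" "y \<in> \<Union>C" for x y
      proof -
        obtain G where "G \<in> C" "x \<in> G" "y \<in> G"
          using xy chain by blast
        then show ?thesis using C by (auto simp: \<A>_def intro: subspace_add)
      qed
      show "c *\<^sub>R x \<in> \<Union>C" if "x \<in> \<Union>C" for c x
        using that C by (auto simp: \<A>_def intro: subspace_scale)
    qed
    moreover have "(\<lambda>x. (x, f x)) ` S \<subseteq> \<Union>C"
      using that(1) C unfolding \<A>_def by blast
    moreover have "\<forall>x r. (x, r) \<in> \<Union>C \<longrightarrow> r \<le> p x"
      using C unfolding \<A>_def by blast
    ultimately show ?thesis by (simp add: \<A>_def)
  qed
  ultimately obtain G where "G \<in> \<A>" and max: "\<And>G'. G' \<in> \<A> \<Longrightarrow> G \<subseteq> G' \<Longrightarrow> G' = G"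
    using subset_Zorn_nonempty[of \<A>] by blast
  then have G: "subspace G" and Gf: "\<And>x. x \<in> S \<Longrightarrow> (x, f x) \<in> G"
    and Gp: "\<And>x r. (x, r) \<in> G \<Longrightarrow> r \<le> p x"
    by (auto simp: \<A>_def)
  have unique: "r = s" if "(x, r) \<in> G" "(x, s) \<in> G" for x r s
    using Gp[of 0 "r - s"] Gp[of 0 "s - r"] subspace_diff[OF G that] subspace_diff[OF G that(2,1)] p0
    by simp
  have total: "\<exists>r. (x, r) \<in> G" for x
  proof (rule ccontr)
    assume no: "\<nexists>r. (x, r) \<in> G"
    have cross: "s - p (z - x) \<le> p (y + x) - r" if "(y, r) \<in> G" "(z, s) \<in> G" for y z r s
      using Gp[of "y + z" "r + s"] subspace_add[OF G that] p_add[of "y + x" "z - x"] by simp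
    define c where "c = (SUP (z, s)\<in>G. s - p (z - x))"
    have "G \<noteq> {}" using subspace_0[OF G] by blast
    have bdd: "bdd_above ((\<lambda>(z, s). s - p (z - x)) ` G)"
      using cross subspace_0[OF G] unfolding zero_prod_def
      by (intro bdd_aboveI2[of _ _ "p (0 + x) - 0"]) (metis case_prod_beta prod.collapse)
    have c1: "s - p (z - x) \<le> c" if "(z, s) \<in> G" for z s
      unfolding c_def using cSUP_upper[OF that bdd] by simp
    have c2: "c \<le> p (y + x) - r" if "(y, r) \<in> G" for y r
      unfolding c_def using \<open>G \<noteq> {}\<close> cross[OF that] by (intro cSUP_least) auto
    define G' where "G' = {u + v |u v. u \<in> G \<and> v \<in> span {(x, c)}}"
    have "G \<subseteq> G'"
    proof
      fix u assume "u \<in> G"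
      then have "u + 0 \<in> G'" unfolding G'_def using span_zero by blast
      then show "u \<in> G'" by simp
    qed
    have "(x, c) \<in> G'"
    proof -
      have "0 + (x, c) \<in> G'" unfolding G'_def using subspace_0[OF G] span_base by blast
      then show ?thesis by simp
    qed
    have "r \<le> p y" if "(y, r) \<in> G'" for y r
    proof -
      obtain z s k where zs: "(z, s) \<in> G" and y: "y = z + k *\<^sub>R x" and r: "r = s + k * c"
        using \<open>(y, r) \<in> G'\<close> by (auto simp: G'_def span_singleton)
      consider "k = 0" | "k > 0" | "k < 0" by linarith
      then show ?thesis
      proof cases
        case 1
        then show ?thesis using Gp zs y r by simp
      next
        case 2
        have "(inverse k *\<^sub>R z, inverse k * s) \<in> G"
          using subspace_scale[OF G zs, of "inverse k"] by simp
        then have "k * c \<le> k * (p (inverse k *\<^sub>R z + x) - inverse k * s)"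
          using c2 2 by (intro mult_left_mono) auto
        also have "\<dots> = p (k *\<^sub>R (inverse k *\<^sub>R z + x)) - s"
          using 2 by (simp add: p_scale right_diff_distrib)
        also have "k *\<^sub>R (inverse k *\<^sub>R z + x) = y"
          using 2 y by (simp add: scaleR_right_distrib)
        finally show ?thesis using r by simp
      next
        case 3
        define l where "l = - k"
        have l: "l > 0" "k = - l" using 3 by (simp_all add: l_def)
        have "(inverse l *\<^sub>R z, inverse l * s) \<in> G"
          using subspace_scale[OF G zs, of "inverse l"] by simp
        then have "l * (inverse l * s - p (inverse l *\<^sub>R z - x)) \<le> l * c"
          using c1 l by (intro mult_left_mono) auto
        moreover have "l * (inverse l * s - p (inverse l *\<^sub>R z - x)) = s - p (l *\<^sub>R (inverse l *\<^sub>R z - x))"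
          using l by (simp add: p_scale right_diff_distrib)
        moreover have "l *\<^sub>R (inverse l *\<^sub>R z - x) = y"
          using l y by (simp add: scaleR_right_diff_distrib)
        ultimately show ?thesis using r l by simp
      qed
    qed
    moreover have "subspace G'"
      unfolding G'_def by (rule subspace_sums[OF G subspace_span])
    ultimately have "G' \<in> \<A>"
      using \<open>G \<subseteq> G'\<close> Gf by (auto simp: \<A>_def)
    then have "G' = G" using max \<open>G \<subseteq> G'\<close> by blast
    then show False using no \<open>(x, c) \<in> G'\<close> by blast
  qed
  define g where "g x = (THE r. (x, r) \<in> G)" for x
  have g: "(x, g x) \<in> G" for x
    unfolding g_def using total unique by (metis (mono_tags, lifting) theI)
  have "linear g"
  proof (rule linearI)
    show "g (x + y) = g x + g y" for x y
      using unique[OF g] subspace_add[OF G g g, of x y] by simp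
    show "g (c *\<^sub>R x) = c *\<^sub>R g x" for c x
      using unique[OF g] subspace_scale[OF G g, of c x] by simp
  qed
  moreover have "\<forall>x\<in>S. g x = f x" using unique[OF g] Gf by blast
  moreover have "\<forall>x. g x \<le> p x" using Gp g by blast
  ultimately show ?thesis by blast
qed

corollary hahn_banach_norm:
  fixes f :: "'a::real_normed_vector \<Rightarrow> real"
  assumes "subspace S"
    and "\<And>x y. x \<in> S \<Longrightarrow> y \<in> S \<Longrightarrow> f (x + y) = f x + f y"
    and "\<And>r x. x \<in> S \<Longrightarrow> f (r *\<^sub>R x) = r * f x"
    and bound: "\<And>x. x \<in> S \<Longrightarrow> \<bar>f x\<bar> \<le> K * norm x" and "0 \<le> K"
  shows "\<exists>g. linear g \<and> (\<forall>x\<in>S. g x = f x) \<and> (\<forall>x. \<bar>g x\<bar> \<le> K * norm x)"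
proof -
  have "\<exists>g. linear g \<and> (\<forall>x\<in>S. g x = f x) \<and> (\<forall>x. g x \<le> K * norm x)"
  proof (rule hahn_banach_sublinear)
    show "f x \<le> K * norm x" if "x \<in> S" for x
      using bound[OF that] by simp
    show "K * norm (x + y) \<le> K * norm x + K * norm y" for x y :: 'a
      using mult_left_mono[OF norm_triangle_ineq \<open>0 \<le> K\<close>] by (simp add: distrib_left)
  qed (use assms in auto)
  then obtain g where g: "linear g" "\<forall>x\<in>S. g x = f x" "\<And>x. g x \<le> K * norm x" by blast
  have "\<bar>g x\<bar> \<le> K * norm x" for x
    using g(3)[of x] g(3)[of "- x"] linear_neg[OF g(1), of x] by simp
  with g show ?thesis by blast
qed


section \<open>Sobczyk's theorem\<close>

text \<open>Uniformly bounded functionals are equicontinuous, so the Cauchy property passes from a dense set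
  to the whole space.\<close>

lemma functionals_converge_on_dense:
  fixes h :: "nat \<Rightarrow> 'a::real_normed_vector \<Rightarrow> real"
  assumes dense: "closure D = UNIV"
    and lin: "\<And>n. linear (h n)" and bound: "\<And>n v. \<bar>h n v\<bar> \<le> C * norm v"
    and conv: "\<And>d. d \<in> D \<Longrightarrow> convergent (\<lambda>n. h n d)"
  obtains L where "linear L" "\<And>v. \<bar>L v\<bar> \<le> C * norm v" "\<And>v. (\<lambda>n. h n v) \<longlonglongrightarrow> L v"
proof -
  have "convergent (\<lambda>n. h n v)" for v
  proof -
    have "Cauchy (\<lambda>n. h n v)"
    proof (rule metric_CauchyI)
      fix e :: real assume "0 < e"
      define \<delta> where "\<delta> = e / (3 * (\<bar>C\<bar> + 1))"
      have \<delta>: "0 < \<delta>" "\<bar>C\<bar> * \<delta> < e / 3"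
        using \<open>0 < e\<close> by (auto simp: \<delta>_def field_simps)
      obtain d where d: "d \<in> D" "dist d v < \<delta>"
        using dense \<delta>(1) closure_approachable[of v D] by auto
      have close: "\<bar>h n v - h n d\<bar> < e / 3" for n
      proof -
        have "\<bar>h n v - h n d\<bar> = \<bar>h n (v - d)\<bar>" by (simp add: linear_diff[OF lin])
        also have "\<dots> \<le> C * norm (v - d)" by (rule bound)
        also have "\<dots> \<le> \<bar>C\<bar> * \<delta>"
          using d(2) by (intro mult_mono) (auto simp: dist_norm norm_minus_commute)
        finally show ?thesis using \<delta>(2) by simp
      qed
      obtain M where M: "\<And>m n. m \<ge> M \<Longrightarrow> n \<ge> M \<Longrightarrow> dist (h m d) (h n d) < e / 3"
        using metric_CauchyD[OF convergent_Cauchy[OF conv[OF d(1)]], of "e / 3"] \<open>0 < e\<close> by auto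
      have "dist (h m v) (h n v) < e" if "m \<ge> M" "n \<ge> M" for m n
        using M[OF that] close[of m] close[of n] unfolding dist_real_def by argo
      then show "\<exists>M. \<forall>m\<ge>M. \<forall>n\<ge>M. dist (h m v) (h n v) < e" by blast
    qed
    then show ?thesis by (rule Cauchy_convergent)
  qed
  then obtain L where L: "\<And>v. (\<lambda>n. h n v) \<longlonglongrightarrow> L v"
    unfolding convergent_def by metis
  have "linear L"
  proof (rule linearI)
    show "L (x + y) = L x + L y" for x y
      using LIMSEQ_unique[OF L[of "x + y"]] tendsto_add[OF L[of x] L[of y]]
      by (simp add: linear_add[OF lin])
    show "L (c *\<^sub>R x) = c *\<^sub>R L x" for c x
      using LIMSEQ_unique[OF L[of "c *\<^sub>R x"]] tendsto_mult_left[OF L[of x], of c]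
      by (simp add: linear_cmul[OF lin])
  qed
  moreover have "\<bar>L v\<bar> \<le> C * norm v" for v
    using bound by (intro LIMSEQ_le_const2[OF tendsto_rabs[OF L]]) auto
  ultimately show ?thesis using that L by blast
qed

text \<open>Veech's argument. The coordinate functionals of \<open>t\<close> extend to \<open>\<phi> n\<close> on the whole space; they
  tend to zero on \<open>Z\<close> only. As the dual ball is weak-star compact and metrizable, all weak-star
  cluster points of \<open>\<phi> n\<close> annihilate \<open>Z\<close>, so that \<open>\<phi> n\<close> comes weak-star close to functionals \<open>\<psi> n\<close>
  that annihilate \<open>Z\<close>. The differences \<open>\<phi> n - \<psi> n\<close> are the coordinates of the extension.\<close>

theorem sobczyk:
  fixes Z :: "'e::real_normed_vector set" and t :: "'e \<Rightarrow> c0"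
  assumes sep: "separable_space (euclidean :: 'e topology)"
    and Z: "subspace Z" and t: "operator_on Z t"
  shows "\<exists>A. bounded_linear A \<and> (\<forall>z\<in>Z. A z = t z)"
proof -
  obtain K0 where K0: "\<And>z. z \<in> Z \<Longrightarrow> norm (t z) \<le> K0 * norm z"
    using t unfolding operator_on_def by blast
  define K where "K = \<bar>K0\<bar>"
  have K: "norm (t z) \<le> K * norm z" if "z \<in> Z" for z
    using K0[OF that] abs_ge_self[of K0] mult_right_mono[OF abs_ge_self[of K0] norm_ge_zero[of z]]
    unfolding K_def by linarith
  have "0 \<le> K" by (simp add: K_def)
  have "\<exists>g. linear g \<and> (\<forall>z\<in>Z. g z = c0_nth (t z) n) \<and> (\<forall>v. \<bar>g v\<bar> \<le> K * norm v)" for n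
  proof (rule hahn_banach_norm[OF Z])
    show "\<bar>c0_nth (t z) n\<bar> \<le> K * norm z" if "z \<in> Z" for z
      using K[OF that] abs_c0_nth_le_norm[of "t z" n] by linarith
  qed (use t \<open>0 \<le> K\<close> in \<open>auto simp: operator_on_def\<close>)
  then obtain \<phi> where \<phi>: "\<And>n. linear (\<phi> n)" "\<And>n z. z \<in> Z \<Longrightarrow> \<phi> n z = c0_nth (t z) n"
      "\<And>n v. \<bar>\<phi> n v\<bar> \<le> K * norm v"
    by metis
  define good where "good \<psi> \<longleftrightarrow> linear \<psi> \<and> (\<forall>v. \<bar>\<psi> v\<bar> \<le> K * norm v) \<and> (\<forall>z\<in>Z. \<psi> z = 0)" for \<psi>
  have good0: "good (\<lambda>_. 0)"
    using \<open>0 \<le> K\<close> by (auto simp: good_def linear_iff)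
  obtain D :: "'e set" where D: "countable D" "closure D = UNIV"
    using sep by (auto simp: separable_space_def)
  then have "D \<noteq> {}" by auto
  define x where "x = from_nat_into D"
  have x: "range x = D"
    unfolding x_def using range_from_nat_into[OF \<open>D \<noteq> {}\<close> D(1)] .
  \<comment> \<open>If infinitely many \<open>\<phi> n\<close> were far from all good functionals, then a weak-star limit of some of
    them would be a good functional, as the coordinates of \<open>t z\<close> tend to zero.\<close>
  have "\<exists>N. \<forall>n\<ge>N. \<exists>\<psi>. good \<psi> \<and> (\<forall>i<m. \<bar>\<phi> n (x i) - \<psi> (x i)\<bar> < 1 / Suc m)" for m
  proof (rule ccontr)
    define bad where "bad n \<longleftrightarrow> \<not> (\<exists>\<psi>. good \<psi> \<and> (\<forall>i<m. \<bar>\<phi> n (x i) - \<psi> (x i)\<bar> < 1 / Suc m))" for n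
    assume "\<not> ?thesis"
    then have "\<forall>N. \<exists>n\<ge>N. bad n" by (simp add: bad_def)
    then have "infinite {n. bad n}"
      unfolding infinite_nat_iff_unbounded_le by simp
    then obtain r :: "nat \<Rightarrow> nat" where r: "strict_mono r" "\<And>n. bad (r n)"
      using infinite_enumerate by blast
    \<comment> \<open>The division by \<open>1 + norm v\<close> turns the bounds \<open>K * norm v\<close> into one that is uniform on \<open>D\<close>.\<close>
    obtain k where k: "strict_mono (k :: nat \<Rightarrow> nat)"
      "\<And>v. v \<in> D \<Longrightarrow> \<exists>l. (\<lambda>n. \<phi> (r (k n)) v / (1 + norm v)) \<longlonglongrightarrow> l"
    proof (rule function_convergent_subsequence[OF D(1), of "\<lambda>n v. \<phi> (r n) v / (1 + norm v)" K])
      show "norm (\<phi> (r n) v / (1 + norm v)) \<le> K" for n v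
      proof -
        have "\<bar>\<phi> (r n) v\<bar> \<le> K * (1 + norm v)"
          using \<phi>(3)[of "r n" v] \<open>0 \<le> K\<close> by (simp add: distrib_left)
        moreover have "0 < 1 + norm v" by (simp add: add_pos_nonneg)
        ultimately show ?thesis by (simp add: pos_divide_le_eq abs_divide)
      qed
    qed blast
    have "convergent (\<lambda>n. \<phi> (r (k n)) v)" if v: "v \<in> D" for v
    proof -
      obtain l where "(\<lambda>n. \<phi> (r (k n)) v / (1 + norm v)) \<longlonglongrightarrow> l" using k(2)[OF v] by blast
      then have "(\<lambda>n. (1 + norm v) * (\<phi> (r (k n)) v / (1 + norm v))) \<longlonglongrightarrow> (1 + norm v) * l"
        by (rule tendsto_mult_left)
      moreover have "1 + norm v \<noteq> 0" using norm_ge_zero[of v] by linarith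
      ultimately show ?thesis by (auto simp: convergent_def)
    qed
    then obtain L where L: "linear L" "\<And>v. \<bar>L v\<bar> \<le> K * norm v" "\<And>v. (\<lambda>n. \<phi> (r (k n)) v) \<longlonglongrightarrow> L v"
      using functionals_converge_on_dense[OF D(2), of "\<lambda>n. \<phi> (r (k n))" K] \<phi> by metis
    have rk: "filterlim (\<lambda>n. r (k n)) sequentially sequentially"
      using filterlim_compose[OF filterlim_subseq[OF r(1)] filterlim_subseq[OF k(1)]] by (simp add: o_def)
    have "L z = 0" if "z \<in> Z" for z
    proof (rule LIMSEQ_unique[OF L(3)])
      have "(\<lambda>n. c0_nth (t z) (r (k n))) \<longlonglongrightarrow> 0"
        by (rule filterlim_compose[OF c0_nth_tendsto_0 rk])
      then show "(\<lambda>n. \<phi> (r (k n)) z) \<longlonglongrightarrow> 0" by (simp add: \<phi>(2) that)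
    qed
    then have "good L" using L by (simp add: good_def)
    have "\<forall>\<^sub>F n in sequentially. \<forall>i\<in>{..<m}. \<bar>\<phi> (r (k n)) (x i) - L (x i)\<bar> < 1 / Suc m"
    proof (rule eventually_ball_finite)
      show "\<forall>i\<in>{..<m}. \<forall>\<^sub>F n in sequentially. \<bar>\<phi> (r (k n)) (x i) - L (x i)\<bar> < 1 / Suc m"
        using tendstoD[OF L(3), of "1 / Suc m"] by (auto simp: dist_real_def)
    qed simp
    then obtain n where "\<forall>i<m. \<bar>\<phi> (r (k n)) (x i) - L (x i)\<bar> < 1 / Suc m"
      by (auto simp: eventually_sequentially)
    then show False using r(2)[of "k n"] \<open>good L\<close> by (auto simp: bad_def)
  qed
  then obtain N where N: "\<And>m n. n \<ge> N m \<Longrightarrow> \<exists>\<psi>. good \<psi> \<and> (\<forall>i<m. \<bar>\<phi> n (x i) - \<psi> (x i)\<bar> < 1 / Suc m)"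
    by metis
  \<comment> \<open>Diagonal choice: the largest admissible precision \<open>m \<le> n\<close> serves for all smaller ones.\<close>
  have "\<exists>\<psi>. good \<psi> \<and> (\<forall>m. m \<le> n \<and> N m \<le> n \<longrightarrow> (\<forall>i<m. \<bar>\<phi> n (x i) - \<psi> (x i)\<bar> < 1 / Suc m))" for n
  proof (cases "\<exists>m. m \<le> n \<and> N m \<le> n")
    case True
    define M where "M = Max {m. m \<le> n \<and> N m \<le> n}"
    have fin: "finite {m. m \<le> n \<and> N m \<le> n}" by simp
    have "M \<in> {m. m \<le> n \<and> N m \<le> n}"
      unfolding M_def using True by (intro Max_in) auto
    then obtain \<psi> where \<psi>: "good \<psi>" "\<And>i. i < M \<Longrightarrow> \<bar>\<phi> n (x i) - \<psi> (x i)\<bar> < 1 / Suc M"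
      using N by blast
    have "\<bar>\<phi> n (x i) - \<psi> (x i)\<bar> < 1 / Suc m" if "m \<le> n" "N m \<le> n" "i < m" for m i
    proof -
      have "m \<le> M" unfolding M_def using that by (intro Max_ge[OF fin]) auto
      then have "1 / real (Suc M) \<le> 1 / Suc m" by (intro divide_left_mono) auto
      then show ?thesis using \<psi>(2)[of i] \<open>m \<le> M\<close> \<open>i < m\<close> by linarith
    qed
    then show ?thesis using \<psi>(1) by blast
  qed (use good0 in blast)
  then obtain \<psi> where \<psi>: "\<And>n. good (\<psi> n)"
      "\<And>n m i. m \<le> n \<Longrightarrow> N m \<le> n \<Longrightarrow> i < m \<Longrightarrow> \<bar>\<phi> n (x i) - \<psi> n (x i)\<bar> < 1 / Suc m"
    by metis
  define \<theta> where "\<theta> n v = \<phi> n v - \<psi> n v" for n v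
  have \<theta>_lin: "linear (\<theta> n)" for n
    unfolding \<theta>_def using \<phi>(1) \<psi>(1) by (intro linear_compose_sub) (auto simp: good_def)
  have \<theta>_bound: "\<bar>\<theta> n v\<bar> \<le> (2 * K) * norm v" for n v
    using \<phi>(3)[of n v] \<psi>(1)[of n] abs_triangle_ineq4[of "\<phi> n v" "\<psi> n v"]
    unfolding good_def \<theta>_def by (smt (verit) distrib_right mult_2)
  have \<theta>_D: "(\<lambda>n. \<theta> n d) \<longlonglongrightarrow> 0" if "d \<in> D" for d
  proof -
    obtain i where i: "d = x i" using \<open>d \<in> D\<close> x by blast
    show ?thesis
    proof (rule LIMSEQ_I)
      fix e :: real assume "0 < e"
      then obtain m0 where m0: "1 / real (Suc m0) < e"
        using reals_Archimedean by (auto simp: inverse_eq_divide)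
      define m where "m = max m0 (Suc i)"
      have le: "1 / real (Suc m) \<le> 1 / Suc m0" by (intro divide_left_mono) (auto simp: m_def)
      have near: "norm (\<theta> n d - 0) < 1 / Suc m" if "n \<ge> max m (N m)" for n
      proof -
        have "i < m" "m \<le> n" "N m \<le> n" using that by (auto simp: m_def)
        then show ?thesis using \<psi>(2)[of m n i] by (simp add: \<theta>_def i)
      qed
      have "norm (\<theta> n d - 0) < e" if "n \<ge> max m (N m)" for n
        using near[OF that] le m0 by linarith
      then show "\<exists>n0. \<forall>n\<ge>n0. norm (\<theta> n d - 0) < e" by blast
    qed
  qed
  obtain L where L: "linear L" "\<And>v. \<bar>L v\<bar> \<le> (2 * K) * norm v" "\<And>v. (\<lambda>n. \<theta> n v) \<longlonglongrightarrow> L v"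
  proof (rule functionals_converge_on_dense[OF D(2) \<theta>_lin \<theta>_bound])
    show "convergent (\<lambda>n. \<theta> n d)" if "d \<in> D" for d
      using \<theta>_D[OF that] by (auto simp: convergent_def)
  qed blast
  have "L v = 0" for v
  proof (rule continuous_constant_on_closure[of D])
    show "continuous_on (closure D) L"
      using L(1,2) by (intro linear_continuous_on bounded_linear_intro[of _ "2 * K"])
        (auto simp: linear_add linear_cmul mult.commute)
    show "L d = 0" if "d \<in> D" for d
      using LIMSEQ_unique[OF L(3) \<theta>_D[OF that]] .
  qed (simp add: D(2))
  then have \<theta>_0: "(\<lambda>n. \<theta> n v) \<longlonglongrightarrow> 0" for v using L(3)[of v] by simp
  have "bounded_linear (\<lambda>v. c0_of (\<lambda>n. \<theta> n v))"
    using \<theta>_bound by (intro bounded_linear_c0_ofI[of _ "2 * K"] \<theta>_0)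
      (auto simp: linear_add[OF \<theta>_lin] linear_cmul[OF \<theta>_lin])
  moreover have "c0_of (\<lambda>n. \<theta> n z) = t z" if "z \<in> Z" for z
    using that \<phi>(2) \<psi>(1) by (intro c0_eqI) (simp add: c0_nth_c0_of[OF \<theta>_0], simp add: \<theta>_def good_def)
  ultimately show ?thesis by blast
qed


section \<open>Distance to a subspace\<close>

lemma infdist_greatest:
  fixes x :: "'a::real_normed_vector"
  assumes "subspace M" "\<And>h. h \<in> M \<Longrightarrow> c \<le> norm (x - h)"
  shows "c \<le> infdist x M"
proof -
  have "M \<noteq> {}" using subspace_0[OF assms(1)] by blast
  then show ?thesis
    using assms(2) by (simp add: infdist_notempty cINF_greatest dist_norm)
qed

lemma infdist_approx:
  fixes x :: "'a::real_normed_vector"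
  assumes "subspace M" "infdist x M < e"
  obtains h where "h \<in> M" "norm (x - h) < e"
  using infdist_greatest[OF assms(1), of e x] assms(2) by (meson not_le)

lemma infdist_le_norm_diff:
  fixes x :: "'a::real_normed_vector"
  shows "h \<in> M \<Longrightarrow> infdist x M \<le> norm (x - h)"
  using infdist_le[of h M x] by (simp add: dist_norm)

lemma infdist_le_norm:
  fixes x :: "'a::real_normed_vector"
  shows "subspace M \<Longrightarrow> infdist x M \<le> norm x"
  using infdist_le_norm_diff[of 0 M x] by (simp add: subspace_0)

lemma infdist_plus_subspace:
  fixes x :: "'a::real_normed_vector"
  assumes M: "subspace M" and "h \<in> M"
  shows "infdist (x + h) M = infdist x M"
proof -
  have le: "infdist (z + k) M \<le> infdist z M" if "k \<in> M" for z k
  proof (rule infdist_greatest[OF M])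
    fix l assume "l \<in> M"
    then show "infdist (z + k) M \<le> norm (z - l)"
      using infdist_le_norm_diff[of "l + k" M "z + k"] subspace_add[OF M _ that] by simp
  qed
  show ?thesis
    using le[OF \<open>h \<in> M\<close>, of x] le[OF subspace_neg[OF M \<open>h \<in> M\<close>], of "x + h"] by simp
qed

lemma infdist_minus_subspace:
  fixes x :: "'a::real_normed_vector"
  assumes "subspace M" "h \<in> M"
  shows "infdist (x - h) M = infdist x M"
  using infdist_plus_subspace[OF assms(1) subspace_neg[OF assms], of x] by simp

lemma infdist_add_le:
  fixes x y :: "'a::real_normed_vector"
  assumes M: "subspace M"
  shows "infdist (x + y) M \<le> infdist x M + infdist y M"
proof (rule field_le_epsilon)
  fix e :: real assume "0 < e"
  obtain h where h: "h \<in> M" "norm (x - h) < infdist x M + e / 2"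
    using infdist_approx[OF M, of x "infdist x M + e / 2"] \<open>0 < e\<close> by auto
  obtain k where k: "k \<in> M" "norm (y - k) < infdist y M + e / 2"
    using infdist_approx[OF M, of y "infdist y M + e / 2"] \<open>0 < e\<close> by auto
  have "infdist (x + y) M \<le> norm (x + y - (h + k))"
    using h k M by (intro infdist_le_norm_diff subspace_add)
  also have "\<dots> \<le> norm (x - h) + norm (y - k)"
    by (rule norm_diff_triangle_ineq)
  finally show "infdist (x + y) M \<le> infdist x M + infdist y M + e" using h k by simp
qed

lemma infdist_scaleR:
  fixes x :: "'a::real_normed_vector"
  assumes M: "subspace M"
  shows "infdist (r *\<^sub>R x) M = \<bar>r\<bar> * infdist x M"
proof (cases "r = 0")
  case True
  then show ?thesis using subspace_0[OF M] by simp
next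
  case False
  have le: "infdist (s *\<^sub>R z) M \<le> \<bar>s\<bar> * infdist z M" if "s \<noteq> 0" for s and z :: 'a
  proof -
    have "inverse \<bar>s\<bar> * infdist (s *\<^sub>R z) M \<le> infdist z M"
    proof (rule infdist_greatest[OF M])
      fix h assume "h \<in> M"
      then have "infdist (s *\<^sub>R z) M \<le> norm (s *\<^sub>R z - s *\<^sub>R h)"
        by (intro infdist_le_norm_diff subspace_scale[OF M])
      also have "\<dots> = \<bar>s\<bar> * norm (z - h)"
        by (simp flip: scaleR_right_diff_distrib)
      finally show "inverse \<bar>s\<bar> * infdist (s *\<^sub>R z) M \<le> norm (z - h)"
        using that by (simp add: field_simps)
    qed
    then show ?thesis using that by (simp add: field_simps)
  qed
  have "\<bar>r\<bar> * infdist x M \<le> infdist (r *\<^sub>R x) M"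
    using le[of "inverse r" "r *\<^sub>R x"] False by (simp add: field_simps)
  then show ?thesis using le[OF False, of x] by simp
qed

lemma quotient_norm_coset:
  assumes "subspace M"
  shows "quotient_norm (coset M x) = infdist x M"
proof -
  have "norm ` coset M x = dist x ` M"
  proof (intro equalityI subsetI)
    fix c assume "c \<in> norm ` coset M x"
    then obtain h where h: "h \<in> M" "c = norm (x + h)" by (auto simp: coset_def)
    then have "c = dist x (- h)" by (simp add: dist_norm)
    then show "c \<in> dist x ` M" using subspace_neg[OF assms h(1)] by (rule image_eqI)
  next
    fix c assume "c \<in> dist x ` M"
    then obtain h where h: "h \<in> M" "c = dist x h" by auto
    then have "c = norm (x + - h)" by (simp add: dist_norm)
    moreover have "x + - h \<in> coset M x"
      unfolding coset_def using subspace_neg[OF assms h(1)] by (rule imageI)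
    ultimately show "c \<in> norm ` coset M x" by (rule image_eqI)
  qed
  moreover have "M \<noteq> {}" using subspace_0[OF assms] by blast
  ultimately show ?thesis by (simp add: quotient_norm_def infdist_notempty)
qed

text \<open>The distance to \<open>M\<close> is a seminorm, so the functional \<open>c *\<^sub>R y \<mapsto> c * infdist y M\<close> on the line
  through \<open>y\<close> extends to one that it dominates.\<close>

lemma norming_functional:
  fixes y :: "'a::real_normed_vector"
  assumes M: "subspace M"
  obtains \<psi> where "linear \<psi>" "\<And>x. \<bar>\<psi> x\<bar> \<le> infdist x M" "\<psi> y = infdist y M"
proof (cases "y = 0")
  case True
  show ?thesis
  proof (rule that)
    show "linear (\<lambda>_::'a. 0::real)" by (simp add: linear_iff)
  qed (use True subspace_0[OF M] in \<open>auto simp: infdist_nonneg\<close>)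
next
  case False
  define f where "f x = (THE c. x = c *\<^sub>R y) * infdist y M" for x
  have f: "f (c *\<^sub>R y) = c * infdist y M" for c
    using False by (simp add: f_def)
  have "\<exists>g. linear g \<and> (\<forall>x\<in>span {y}. g x = f x) \<and> (\<forall>x. g x \<le> infdist x M)"
  proof (rule hahn_banach_sublinear)
    show "f (a + b) = f a + f b" if "a \<in> span {y}" "b \<in> span {y}" for a b
      using that by (auto simp: span_singleton f distrib_right simp flip: scaleR_left_distrib)
    show "f (r *\<^sub>R a) = r * f a" if "a \<in> span {y}" for r a
      using that by (auto simp: span_singleton f)
    show "f a \<le> infdist a M" if "a \<in> span {y}" for a
      using that by (auto simp: span_singleton f infdist_scaleR[OF M] infdist_nonneg intro!: mult_right_mono)
  qed (auto simp: infdist_add_le infdist_scaleR M)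
  then obtain g where g: "linear g" "\<forall>x\<in>span {y}. g x = f x" "\<And>x. g x \<le> infdist x M" by blast
  show ?thesis
  proof (rule that[OF g(1)])
    show "\<bar>g x\<bar> \<le> infdist x M" for x
      using g(3)[of x] g(3)[of "- x"] linear_neg[OF g(1), of x] infdist_scaleR[OF M, of "- 1" x] by simp
    show "g y = infdist y M"
      using g(2) f[of 1] by (simp add: span_base)
  qed
qed

text \<open>The distance to \<open>G\<close> does not change when an element of \<open>G\<close> is subtracted from \<open>v\<close>. Subtracting a
  nearly best approximation therefore gives a vector whose distance to \<open>G\<close> is more than half its
  norm, unless \<open>v \<in> G\<close>. This replaces an iteration of the estimate.\<close>

lemma eq_UNIV_if_infdist_le_half:
  fixes G :: "'a::real_normed_vector set"
  assumes G: "subspace G" "closed G" and half: "\<And>v. infdist v G \<le> norm v / 2"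
  shows "G = UNIV"
proof -
  have "v \<in> G" for v
  proof (rule ccontr)
    assume "v \<notin> G"
    then have pos: "0 < infdist v G"
      using infdist_pos_not_in_closed[of G v] G subspace_0[OF G(1)] by blast
    then obtain g where g: "g \<in> G" "norm (v - g) < 2 * infdist v G"
      using infdist_approx[OF G(1), of v "2 * infdist v G"] by auto
    show False
      using half[of "v - g"] g(2) infdist_minus_subspace[OF G(1) g(1), of v] by simp
  qed
  then show ?thesis by blast
qed


section \<open>Subspaces at a positive angle\<close>

text \<open>The condition says that the quotient map by \<open>H\<close> is bounded below on \<open>R\<close>. It forces the sum of
  \<open>R\<close> and \<open>H\<close> to be direct and, for closed \<open>R\<close> and \<open>H\<close> in a Banach space, closed.\<close>

definition transversal :: "'a::real_normed_vector set \<Rightarrow> 'a set \<Rightarrow> bool" where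
  "transversal H R \<longleftrightarrow> subspace R \<and> (\<exists>C. \<forall>r\<in>R. norm r \<le> C * infdist r H)"

lemma transversal_constant:
  assumes "transversal H R"
  obtains C where "0 < C" "\<And>r. r \<in> R \<Longrightarrow> norm r \<le> C * infdist r H"
proof -
  obtain C where C: "\<And>r. r \<in> R \<Longrightarrow> norm r \<le> C * infdist r H"
    using assms by (auto simp: transversal_def)
  have "norm r \<le> (\<bar>C\<bar> + 1) * infdist r H" if "r \<in> R" for r
    using C[OF that] mult_right_mono[of C "\<bar>C\<bar> + 1" "infdist r H"] infdist_nonneg[of r H] by linarith
  then show ?thesis using that[of "\<bar>C\<bar> + 1"] by simp
qed

lemma subspace_closure:
  fixes S :: "'a::real_normed_vector set"
  assumes S: "subspace S"
  shows "subspace (closure S)"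
proof (rule subspaceI)
  show "0 \<in> closure S" using subspace_0[OF S] closure_subset by blast
  show "x + y \<in> closure S" if xy: "x \<in> closure S" "y \<in> closure S" for x y
  proof -
    obtain f g where "\<And>n. f n \<in> S" "f \<longlonglongrightarrow> x" "\<And>n. g n \<in> S" "g \<longlonglongrightarrow> y"
      using xy unfolding closure_sequential by metis
    then have "\<forall>n. f n + g n \<in> S" "(\<lambda>n. f n + g n) \<longlonglongrightarrow> x + y"
      by (auto intro: subspace_add[OF S] tendsto_add)
    then show ?thesis unfolding closure_sequential by (intro exI[of _ "\<lambda>n. f n + g n"] conjI)
  qed
  show "c *\<^sub>R x \<in> closure S" if x: "x \<in> closure S" for c x
  proof -
    obtain f where "\<And>n. f n \<in> S" "f \<longlonglongrightarrow> x"
      using x unfolding closure_sequential by metis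
    then have "\<forall>n. c *\<^sub>R f n \<in> S" "(\<lambda>n. c *\<^sub>R f n) \<longlonglongrightarrow> c *\<^sub>R x"
      by (auto intro: subspace_scale[OF S] tendsto_intros)
    then show ?thesis unfolding closure_sequential by (intro exI[of _ "\<lambda>n. c *\<^sub>R f n"] conjI)
  qed
qed

lemma transversal_closure:
  assumes "transversal H R"
  shows "transversal H (closure R)"
proof -
  obtain C where C: "\<And>r. r \<in> R \<Longrightarrow> norm r \<le> C * infdist r H"
    using transversal_constant[OF assms] by blast
  have "norm r \<le> C * infdist r H" if r: "r \<in> closure R" for r
  proof -
    obtain f where f: "\<And>n. f n \<in> R" "f \<longlonglongrightarrow> r"
      using r unfolding closure_sequential by metis
    show ?thesis
    proof (rule LIMSEQ_le)
      show "(\<lambda>n. norm (f n)) \<longlonglongrightarrow> norm r" "(\<lambda>n. C * infdist (f n) H) \<longlonglongrightarrow> C * infdist r H"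
        using f(2) by (auto intro!: tendsto_intros)
    qed (use C f(1) in auto)
  qed
  then show ?thesis
    using assms subspace_closure by (auto simp: transversal_def)
qed

abbreviation subspace_sum :: "'a::real_vector set \<Rightarrow> 'a set \<Rightarrow> 'a set" where
  "subspace_sum R H \<equiv> {r + h |r h. r \<in> R \<and> h \<in> H}"

lemma closed_transversal_sum:
  fixes H :: "'a::banach set"
  assumes tr: "transversal H R" and R: "closed R" and H: "subspace H" "closed H"
  shows "closed (subspace_sum R H)"
proof -
  obtain C where C: "0 < C" "\<And>r. r \<in> R \<Longrightarrow> norm r \<le> C * infdist r H"
    using transversal_constant[OF tr] by blast
  have sub: "subspace R" using tr by (simp add: transversal_def)
  have "l \<in> subspace_sum R H" if x: "\<And>n. x n \<in> subspace_sum R H" and lim: "x \<longlonglongrightarrow> l" for x l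
  proof -
    have "\<forall>n. \<exists>r h. r \<in> R \<and> h \<in> H \<and> x n = r + h" using x by blast
    then obtain r h where rh: "\<And>n. r n \<in> R" "\<And>n. h n \<in> H" "\<And>n. x n = r n + h n" by metis
    have lip: "norm (r m - r n) \<le> C * norm (x m - x n)" for m n
    proof -
      have "norm (r m - r n) \<le> C * infdist (r m - r n) H"
        using rh by (intro C(2) subspace_diff[OF sub])
      also have "infdist (r m - r n) H = infdist (r m - r n + (h m - h n)) H"
        using rh by (intro infdist_plus_subspace[symmetric] H subspace_diff)
      also have "r m - r n + (h m - h n) = x m - x n"
        by (simp add: rh(3))
      also have "C * infdist (x m - x n) H \<le> C * norm (x m - x n)"
        using C(1) infdist_le_norm[OF H(1)] by (intro mult_left_mono) auto
      finally show ?thesis .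
    qed
    have "Cauchy r"
    proof (rule CauchyI)
      fix e :: real assume "0 < e"
      then obtain M where "\<And>m n. m \<ge> M \<Longrightarrow> n \<ge> M \<Longrightarrow> norm (x m - x n) < e / C"
        using CauchyD[OF LIMSEQ_imp_Cauchy[OF lim], of "e / C"] C(1) by auto
      then have "norm (r m - r n) < e" if "m \<ge> M" "n \<ge> M" for m n
        using that lip[of m n] C(1) by (smt (verit, ccfv_SIG) mult.commute pos_less_divide_eq)
      then show "\<exists>M. \<forall>m\<ge>M. \<forall>n\<ge>M. norm (r m - r n) < e" by blast
    qed
    then obtain r0 where r0: "r \<longlonglongrightarrow> r0"
      using Cauchy_convergent convergent_def by blast
    then have "r0 \<in> R" using closed_sequentially[OF R] rh(1) by blast
    moreover have "(\<lambda>n. x n - r n) \<longlonglongrightarrow> l - r0" by (intro tendsto_diff lim r0)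
    then have "h \<longlonglongrightarrow> l - r0" by (simp add: rh(3))
    then have "l - r0 \<in> H" using closed_sequentially[OF H(2)] rh(2) by blast
    ultimately have "r0 + (l - r0) \<in> subspace_sum R H" by blast
    then show ?thesis by simp
  qed
  then show ?thesis unfolding closed_sequential_limits by blast
qed

text \<open>If \<open>f\<close> has distance \<open>\<delta> > 0\<close> from the closed sum of \<open>R\<close> and \<open>H\<close>, then the coefficient of \<open>f\<close> in
  \<open>r + c *\<^sub>R f\<close> is at most \<open>1 / \<delta>\<close> times the distance to \<open>H\<close>, and so \<open>r\<close> is controlled as well.\<close>

lemma transversal_add_vector:
  fixes H :: "'a::banach set"
  assumes tr: "transversal H R" and R: "closed R" and H: "subspace H" "closed H"
  obtains R' where "transversal H R'" "closed R'" "R \<subseteq> R'" "f \<in> subspace_sum R' H"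
proof (cases "f \<in> subspace_sum R H")
  case True
  then show ?thesis using that tr R by blast
next
  case False
  obtain C where C: "0 < C" "\<And>r. r \<in> R \<Longrightarrow> norm r \<le> C * infdist r H"
    using transversal_constant[OF tr] by blast
  have subR: "subspace R" using tr by (simp add: transversal_def)
  let ?G = "subspace_sum R H"
  have G: "subspace ?G" by (rule subspace_sums[OF subR H(1)])
  have clG: "closed ?G" by (rule closed_transversal_sum[OF assms])
  define \<delta> where "\<delta> = infdist f ?G"
  have \<delta>: "0 < \<delta>" unfolding \<delta>_def
    using infdist_pos_not_in_closed[OF clG _ False] subspace_0[OF G] by blast
  have HG: "H \<subseteq> ?G" using subspace_0[OF subR] by force
  let ?S = "subspace_sum R (span {f})"
  have "norm s \<le> (C * (1 + norm f / \<delta>) + norm f / \<delta>) * infdist s H" if s_in: "s \<in> ?S" for s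
  proof -
    obtain r c where r: "r \<in> R" and s: "s = r + c *\<^sub>R f"
      using s_in by (auto simp: span_singleton)
    have "r \<in> ?G" using r subspace_0[OF H(1)] by force
    then have "infdist (c *\<^sub>R f + r) ?G = infdist (c *\<^sub>R f) ?G"
      by (rule infdist_plus_subspace[OF G])
    then have "\<bar>c\<bar> * \<delta> = infdist s ?G"
      unfolding s \<delta>_def infdist_scaleR[OF G] by (simp only: add.commute)
    also have "\<dots> \<le> infdist s H"
      using HG subspace_0[OF H(1)] by (intro infdist_mono) auto
    finally have c: "\<bar>c\<bar> \<le> infdist s H / \<delta>" using \<delta> by (simp add: field_simps)
    have cf: "\<bar>c\<bar> * norm f \<le> infdist s H / \<delta> * norm f"
      by (intro mult_right_mono c) auto
    have "infdist r H \<le> infdist s H + infdist ((- c) *\<^sub>R f) H"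
      using infdist_add_le[OF H(1), of s "(- c) *\<^sub>R f"] by (simp add: s)
    also have "infdist ((- c) *\<^sub>R f) H \<le> \<bar>c\<bar> * norm f"
      using infdist_le_norm[OF H(1), of "(- c) *\<^sub>R f"] by simp
    finally have "infdist r H \<le> infdist s H + infdist s H / \<delta> * norm f" using cf by simp
    then have "norm r \<le> C * (infdist s H + infdist s H / \<delta> * norm f)"
      using C(2)[OF r] C(1) by (meson mult_left_mono less_imp_le order_trans)
    moreover have "norm s \<le> norm r + \<bar>c\<bar> * norm f"
      unfolding s using norm_triangle_ineq[of r "c *\<^sub>R f"] by simp
    ultimately have "norm s \<le> C * (infdist s H + infdist s H / \<delta> * norm f) + infdist s H / \<delta> * norm f"
      using cf by simp
    also have "\<dots> = (C * (1 + norm f / \<delta>) + norm f / \<delta>) * infdist s H"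
      by (simp add: algebra_simps)
    finally show ?thesis .
  qed
  moreover have "subspace ?S" by (intro subspace_sums subR subspace_span)
  ultimately have "transversal H ?S" by (auto simp: transversal_def)
  then have "transversal H (closure ?S)" by (rule transversal_closure)
  moreover have "R \<subseteq> closure ?S"
  proof -
    have "R \<subseteq> ?S" using span_zero[of "{f}"] by force
    then show ?thesis using closure_subset by blast
  qed
  moreover have "f \<in> subspace_sum (closure ?S) H"
  proof -
    have "0 + f \<in> ?S" using subspace_0[OF subR] span_base[of f "{f}"] by blast
    then have "f \<in> closure ?S" using closure_subset by fastforce
    then have "f + 0 \<in> subspace_sum (closure ?S) H" using subspace_0[OF H(1)] by blast
    then show ?thesis by simp
  qed
  ultimately show ?thesis using that by blast
qed

lemma transversal_add_finite:
  fixes H :: "'a::banach set"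
  assumes "finite F" and tr: "transversal H R" and R: "closed R" and H: "subspace H" "closed H"
  obtains R' where "transversal H R'" "closed R'" "R \<subseteq> R'" "F \<subseteq> subspace_sum R' H"
  using \<open>finite F\<close>
proof (induction arbitrary: thesis rule: finite_induct)
  case empty
  then show ?case using tr R by blast
next
  case (insert f F)
  obtain R1 where R1: "transversal H R1" "closed R1" "R \<subseteq> R1" "F \<subseteq> subspace_sum R1 H"
    using insert.IH by blast
  obtain R2 where R2: "transversal H R2" "closed R2" "R1 \<subseteq> R2" "f \<in> subspace_sum R2 H"
    using transversal_add_vector[OF R1(1,2) H] by blast
  show ?case
  proof (rule insert.prems[OF R2(1,2)])
    show "R \<subseteq> R2" using R1(3) R2(3) by blast
    have "F \<subseteq> subspace_sum R2 H" using R1(4) R2(3) by blast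
    then show "insert f F \<subseteq> subspace_sum R2 H" using R2(4) by blast
  qed
qed

text \<open>The projection onto \<open>R\<close> along \<open>H\<close> is bounded because the norm of \<open>p x\<close> is controlled by the
  distance of \<open>p x\<close> to \<open>H\<close>, which is that of \<open>x\<close>.\<close>

lemma transversal_sum_UNIV_projection:
  fixes H :: "'a::real_normed_vector set"
  assumes tr: "transversal H R" and H: "subspace H" and sum: "subspace_sum R H = UNIV"
  obtains p where "bounded_linear p" "\<And>x. x - p x \<in> H" "\<And>h. h \<in> H \<Longrightarrow> p h = 0"
proof -
  obtain C where C: "0 < C" "\<And>r. r \<in> R \<Longrightarrow> norm r \<le> C * infdist r H"
    using transversal_constant[OF tr] by blast
  have subR: "subspace R" using tr by (simp add: transversal_def)
  have "\<exists>r. r \<in> R \<and> x - r \<in> H" for x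
  proof -
    have "x \<in> subspace_sum R H" using sum by blast
    then show ?thesis by force
  qed
  then obtain p where p: "\<And>x. p x \<in> R" "\<And>x. x - p x \<in> H" by metis
  have uniq: "p x = r" if "r \<in> R" "x - r \<in> H" for x r
  proof -
    have "p x - r \<in> R" using p(1) that(1) by (rule subspace_diff[OF subR])
    moreover have "p x - r \<in> H" using subspace_diff[OF H that(2) p(2)[of x]] by simp
    ultimately have "norm (p x - r) \<le> 0" using C(2)[of "p x - r"] by simp
    then show ?thesis by simp
  qed
  show ?thesis
  proof (rule that)
    show "p h = 0" if "h \<in> H" for h
      using that by (intro uniq) (auto simp: subspace_0[OF subR])
    show "bounded_linear p"
    proof (rule bounded_linear_intro[of _ C])
      show "p (x + y) = p x + p y" for x y
        using subspace_add[OF H p(2)[of x] p(2)[of y]]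
        by (intro uniq subspace_add[OF subR] p) (simp add: algebra_simps)
      show "p (c *\<^sub>R x) = c *\<^sub>R p x" for c x
        using subspace_scale[OF H p(2)[of x], of c]
        by (intro uniq subspace_scale[OF subR] p) (simp add: scaleR_right_diff_distrib)
      show "norm (p x) \<le> norm x * C" for x
      proof -
        have "infdist (p x) H = infdist x H"
          using infdist_minus_subspace[OF H p(2)[of x], of x] by simp
        also have "\<dots> \<le> norm x" by (rule infdist_le_norm[OF H])
        finally show ?thesis
          using C(2)[OF p(1)[of x]] C(1) by (metis mult.commute mult_le_cancel_left_pos order_trans)
      qed
    qed
  qed (rule p(2))
qed


section \<open>Operators that are the identity on a subspace and small on tails modulo it\<close>

text \<open>The common kernel of finitely many functionals on \<open>A\<close> has a finite-dimensional supplement in \<open>A\<close>: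
  each functional that does not vanish on the kernel of the previous ones contributes one vector.\<close>

lemma finitely_many_functionals_finite_codim:
  fixes A :: "'a::real_vector set" and \<Phi> :: "('a \<Rightarrow> real) set"
  assumes "finite \<Phi>" and A: "subspace A" and lin: "\<And>\<phi>. \<phi> \<in> \<Phi> \<Longrightarrow> linear \<phi>"
  obtains F where "finite F" "F \<subseteq> A" "\<And>x. x \<in> A \<Longrightarrow> \<exists>f\<in>span F. \<forall>\<phi>\<in>\<Phi>. \<phi> (x - f) = 0"
  using assms(1,3)
proof (induction arbitrary: thesis rule: finite_induct)
  case empty
  show ?case by (rule empty.prems(1)[of "{}"]) auto
next
  case (insert \<phi> \<Phi>)
  obtain F where F: "finite F" "F \<subseteq> A" "\<And>x. x \<in> A \<Longrightarrow> \<exists>f\<in>span F. \<forall>\<phi>\<in>\<Phi>. \<phi> (x - f) = 0"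
    using insert.IH insert.prems(2) by blast
  have lin: "linear \<phi>" "\<And>\<phi>'. \<phi>' \<in> \<Phi> \<Longrightarrow> linear \<phi>'" using insert.prems(2) by auto
  have span: "span F \<subseteq> A" using span_minimal[OF F(2) A] .
  show ?case
  proof (cases "\<exists>u\<in>A. (\<forall>\<phi>'\<in>\<Phi>. \<phi>' u = 0) \<and> \<phi> u \<noteq> 0")
    case True
    then obtain u where u: "u \<in> A" "\<And>\<phi>'. \<phi>' \<in> \<Phi> \<Longrightarrow> \<phi>' u = 0" "\<phi> u \<noteq> 0" by blast
    show ?thesis
    proof (rule insert.prems(1)[of "insert u F"])
      fix x assume "x \<in> A"
      then obtain f where f: "f \<in> span F" "\<And>\<phi>'. \<phi>' \<in> \<Phi> \<Longrightarrow> \<phi>' (x - f) = 0" using F(3) by blast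
      define f' where "f' = f + (\<phi> (x - f) / \<phi> u) *\<^sub>R u"
      have "f' \<in> span (insert u F)"
        unfolding f'_def using f(1) span_mono[of F "insert u F"]
        by (intro span_add span_scale) (auto intro: span_base)
      moreover have "\<phi> (x - f') = 0"
        using u(3) by (simp add: f'_def linear_diff[OF lin(1)] linear_add[OF lin(1)] linear_cmul[OF lin(1)])
      moreover have "\<phi>' (x - f') = 0" if "\<phi>' \<in> \<Phi>" for \<phi>'
        using f(2)[OF that] u(2)[OF that] linear_diff[OF lin(2)[OF that]]
        by (simp add: f'_def linear_add[OF lin(2)[OF that]] linear_cmul[OF lin(2)[OF that]])
      ultimately show "\<exists>f\<in>span (insert u F). \<forall>\<phi>'\<in>insert \<phi> \<Phi>. \<phi>' (x - f) = 0" by blast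
    qed (use F u in auto)
  next
    case False
    show ?thesis
    proof (rule insert.prems(1)[OF F(1,2)])
      fix x assume x: "x \<in> A"
      then obtain f where f: "f \<in> span F" "\<forall>\<phi>'\<in>\<Phi>. \<phi>' (x - f) = 0" using F(3) by blast
      have "x - f \<in> A" using x f(1) span by (intro subspace_diff[OF A]) auto
      then show "\<exists>f\<in>span F. \<forall>\<phi>'\<in>insert \<phi> \<Phi>. \<phi>' (x - f) = 0"
        using False f by blast
    qed
  qed
qed

text \<open>The functionals \<open>\<psi> \<circ> U\<close>, where \<open>\<psi>\<close> runs through the dual ball of the quotient by \<open>H\<close>, form a
  totally bounded set: they are uniformly small on a tail, and their values at the remaining unit
  vectors are bounded. A finite net consists of functionals whose common kernel is the subspace on
  which \<open>U\<close> is small modulo \<open>H\<close>. The identity \<open>U h = h\<close> on \<open>H\<close> turns the estimate in terms of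
  \<open>norm y\<close> into one in terms of the distance of \<open>y\<close> to \<open>H\<close>.\<close>

lemma small_on_finite_codim:
  fixes H :: "c0 set" and U :: "c0 \<Rightarrow> c0"
  assumes H: "subspace H" and U: "bounded_linear U" and UH: "\<And>h. h \<in> H \<Longrightarrow> U h = h"
    and small: "\<And>e. 0 < e \<Longrightarrow> \<exists>N. \<forall>x. infdist (U (c0_tail N x)) H \<le> e * norm x"
  obtains \<Phi> where "finite \<Phi>" "\<And>\<phi>. \<phi> \<in> \<Phi> \<Longrightarrow> linear \<phi>"
    "\<And>y. (\<And>\<phi>. \<phi> \<in> \<Phi> \<Longrightarrow> \<phi> y = (0::real)) \<Longrightarrow> infdist (U y) H \<le> infdist y H / 2"
proof -
  interpret U: bounded_linear U by (rule U)
  obtain N where N: "\<And>x. infdist (U (c0_tail N x)) H \<le> 1 / 8 * norm x"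
    using small[of "1 / 8"] by auto
  obtain C where C: "\<And>x. norm (U x) \<le> norm x * C" and "0 \<le> C"
    using U.nonneg_bounded by blast
  define \<Psi> where "\<Psi> = {\<psi>. linear \<psi> \<and> (\<forall>x. \<bar>\<psi> x\<bar> \<le> infdist x H)}"
  define B where "B = 8 * (real N + 1)"
  have B: "0 < B" by (simp add: B_def)
  \<comment> \<open>The net: functionals with the same signature differ by at most \<open>1 / B\<close> at \<open>U (c0_unit i)\<close> for
    \<open>i < N\<close>, and the \<open>N\<close> resulting errors add up to less than a quarter.\<close>
  define sig where "sig \<psi> = restrict (\<lambda>i. \<lfloor>B * \<psi> (U (c0_unit i))\<rfloor>) {..<N}" for \<psi> :: "c0 \<Rightarrow> real"
  define K where "K = \<lceil>B * C\<rceil> + 1"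
  have "sig ` \<Psi> \<subseteq> Pi\<^sub>E {..<N} (\<lambda>_. {-K..K})"
  proof clarify
    fix \<psi> assume \<psi>: "\<psi> \<in> \<Psi>"
    have "\<lfloor>B * \<psi> (U (c0_unit i))\<rfloor> \<in> {-K..K}" for i
    proof -
      have "norm (c0_unit i) \<le> 1" by (rule norm_c0_le) auto
      then have "norm (U (c0_unit i)) \<le> 1 * C"
        using C[of "c0_unit i"] \<open>0 \<le> C\<close> by (meson mult_right_mono order_trans)
      then have "\<bar>\<psi> (U (c0_unit i))\<bar> \<le> C"
        using \<psi> infdist_le_norm[OF H, of "U (c0_unit i)"] unfolding \<Psi>_def
        by (smt (verit, best) mem_Collect_eq mult_1)
      then have "\<bar>B * \<psi> (U (c0_unit i))\<bar> \<le> B * C"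
        using B by (simp add: abs_mult)
      then show ?thesis unfolding K_def by (auto simp: le_floor_iff floor_le_iff) linarith+
    qed
    then show "sig \<psi> \<in> Pi\<^sub>E {..<N} (\<lambda>_. {-K..K})" by (auto simp: sig_def)
  qed
  then have "finite (sig ` \<Psi>)"
    by (rule finite_subset) (intro finite_PiE finite_lessThan finite_atLeastAtMost_int)
  then obtain \<Psi>0 where \<Psi>0: "\<Psi>0 \<subseteq> \<Psi>" "finite \<Psi>0" "sig ` \<Psi> = sig ` \<Psi>0"
    using finite_subset_image[of "sig ` \<Psi>" sig \<Psi>] by blast
  show ?thesis
  proof (rule that[of "(\<lambda>\<psi>. \<psi> \<circ> U) ` \<Psi>0"])
    show "linear \<phi>" if "\<phi> \<in> (\<lambda>\<psi>. \<psi> \<circ> U) ` \<Psi>0" for \<phi>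
      using that \<Psi>0(1) U.linear by (auto simp: \<Psi>_def intro!: linear_compose)
    fix y assume ker: "\<And>\<phi>. \<phi> \<in> (\<lambda>\<psi>. \<psi> \<circ> U) ` \<Psi>0 \<Longrightarrow> \<phi> y = 0"
    obtain \<psi> where \<psi>: "linear \<psi>" "\<And>x. \<bar>\<psi> x\<bar> \<le> infdist x H" "\<psi> (U y) = infdist (U y) H"
      using norming_functional[OF H, of "U y"] by blast
    then have "\<psi> \<in> \<Psi>" by (simp add: \<Psi>_def)
    then obtain \<psi>0 where "\<psi>0 \<in> \<Psi>0" and sig: "sig \<psi> = sig \<psi>0" using \<Psi>0(3) by (metis imageE imageI)
    then have \<psi>0: "linear \<psi>0" "\<And>x. \<bar>\<psi>0 x\<bar> \<le> infdist x H" "\<psi>0 (U y) = 0"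
      using \<Psi>0(1) ker[of "\<psi>0 \<circ> U"] by (auto simp: \<Psi>_def)
    define \<eta> where "\<eta> x = \<psi> x - \<psi>0 x" for x
    have lin: "linear \<eta>" unfolding \<eta>_def by (intro linear_compose_sub \<psi>(1) \<psi>0(1))
    have \<eta>: "\<bar>\<eta> x\<bar> \<le> 2 * infdist x H" for x
      using \<psi>(2)[of x] \<psi>0(2)[of x] by (simp add: \<eta>_def)
    have unit: "\<bar>\<eta> (U (c0_unit i))\<bar> \<le> 1 / B" if "i < N" for i
    proof -
      have "\<lfloor>B * \<psi> (U (c0_unit i))\<rfloor> = \<lfloor>B * \<psi>0 (U (c0_unit i))\<rfloor>"
        using fun_cong[OF sig, of i] that by (simp add: sig_def)
      then have "\<bar>B * \<psi> (U (c0_unit i)) - B * \<psi>0 (U (c0_unit i))\<bar> \<le> 1" by linarith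
      then have "B * \<bar>\<eta> (U (c0_unit i))\<bar> \<le> 1"
        using B by (simp add: \<eta>_def abs_mult flip: right_diff_distrib)
      then show ?thesis using B by (simp add: field_simps)
    qed
    have "2 * infdist (U y) H \<le> infdist y H"
    proof (rule infdist_greatest[OF H])
      fix h assume "h \<in> H"
      define z where "z = y - h"
      have "\<eta> h = 0" using \<eta>[of h] \<open>h \<in> H\<close> by simp
      have "U y = U z + h" using UH[OF \<open>h \<in> H\<close>] by (simp add: z_def U.diff)
      then have "\<eta> (U y) = \<eta> (U z + h)" by simp
      also have "\<eta> (U z + h) = \<eta> (U z)" using \<open>\<eta> h = 0\<close> by (simp add: linear_add[OF lin])
      also have "U z = (\<Sum>i<N. c0_nth z i *\<^sub>R U (c0_unit i)) + U (c0_tail N z)"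
        unfolding U.scaleR[symmetric] U.sum[symmetric] U.add[symmetric] c0_head_eq_sum[symmetric] by simp
      also have "\<eta> \<dots> = (\<Sum>i<N. c0_nth z i * \<eta> (U (c0_unit i))) + \<eta> (U (c0_tail N z))"
        by (simp add: linear_add[OF lin] linear_sum[OF lin] linear_cmul[OF lin])
      also have "\<dots> \<le> real N * (norm z * (1 / B)) + 1 / 4 * norm z"
      proof (rule add_mono)
        have "(\<Sum>i<N. c0_nth z i * \<eta> (U (c0_unit i))) \<le> (\<Sum>i<N. norm z * (1 / B))"
        proof (rule sum_mono)
          fix i assume "i \<in> {..<N}"
          then have "\<bar>c0_nth z i\<bar> * \<bar>\<eta> (U (c0_unit i))\<bar> \<le> norm z * (1 / B)"
            by (intro mult_mono abs_c0_nth_le_norm unit) auto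
          then show "c0_nth z i * \<eta> (U (c0_unit i)) \<le> norm z * (1 / B)"
            by (simp flip: abs_mult)
        qed
        then show "(\<Sum>i<N. c0_nth z i * \<eta> (U (c0_unit i))) \<le> real N * (norm z * (1 / B))" by simp
        show "\<eta> (U (c0_tail N z)) \<le> 1 / 4 * norm z"
          using \<eta>[of "U (c0_tail N z)"] N[of z] by linarith
      qed
      also have "\<dots> \<le> norm z / 2"
      proof -
        have "real N / B \<le> 1 / 4" by (simp add: B_def field_simps)
        then have "norm z * (real N / B) \<le> norm z * (1 / 4)" by (intro mult_left_mono) auto
        moreover have "real N * (norm z * (1 / B)) = norm z * (real N / B)" by simp
        ultimately show ?thesis by linarith
      qed
      finally have "\<eta> (U y) \<le> norm z / 2" .
      moreover have "infdist (U y) H = \<eta> (U y)" using \<psi>(3) \<psi>0(3) by (simp add: \<eta>_def)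
      ultimately show "2 * infdist (U y) H \<le> norm (y - h)" by (simp add: z_def)
    qed
    then show "infdist (U y) H \<le> infdist y H / 2" by simp
  qed (use \<Psi>0(2) in auto)
qed

text \<open>With \<open>P x = x - U x\<close>, which annihilates \<open>H\<close>, the image under \<open>P\<close> of a subspace of finite
  codimension is at a positive angle to \<open>H\<close>. This image, finitely many vectors and \<open>H\<close> together span
  a closed subspace that contains \<open>x - U (c0_tail N x)\<close> for all \<open>x\<close>. Modulo this subspace every \<open>x\<close> is
  thus equal to the vector \<open>U (c0_tail N x)\<close>, which has at most half the norm of \<open>x\<close> modulo \<open>H\<close>, so
  the subspace is everything.\<close>

theorem complemented_if_small_on_tails:
  fixes H :: "c0 set" and U :: "c0 \<Rightarrow> c0"
  assumes H: "subspace H" "closed H" and U: "bounded_linear U" and UH: "\<And>h. h \<in> H \<Longrightarrow> U h = h"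
    and small: "\<And>e. 0 < e \<Longrightarrow> \<exists>N. \<forall>x. infdist (U (c0_tail N x)) H \<le> e * norm x"
  obtains p where "bounded_linear p" "\<And>x. x - p x \<in> H" "\<And>h. h \<in> H \<Longrightarrow> p h = 0"
proof -
  interpret U: bounded_linear U by (rule U)
  obtain \<Phi> where \<Phi>: "finite \<Phi>" "\<And>\<phi>. \<phi> \<in> \<Phi> \<Longrightarrow> linear \<phi>"
    "\<And>y. (\<And>\<phi>. \<phi> \<in> \<Phi> \<Longrightarrow> \<phi> y = (0::real)) \<Longrightarrow> infdist (U y) H \<le> infdist y H / 2"
    using small_on_finite_codim[OF H(1) U UH small] by metis
  define Y where "Y = {y. \<forall>\<phi>\<in>\<Phi>. \<phi> y = 0}"
  have Y: "subspace Y"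
  proof -
    have "Y = (\<Inter>\<phi>\<in>\<Phi>. {y. \<phi> y = 0})" by (auto simp: Y_def)
    then show ?thesis by (auto intro!: subspace_Inter linear_subspace_kernel \<Phi>(2))
  qed
  obtain F where F: "finite F" "\<And>x. \<exists>f\<in>span F. x - f \<in> Y"
  proof (rule finitely_many_functionals_finite_codim[OF \<Phi>(1) subspace_UNIV \<Phi>(2)])
    fix F assume F: "finite F" "\<And>x. x \<in> UNIV \<Longrightarrow> \<exists>f\<in>span F. \<forall>\<phi>\<in>\<Phi>. \<phi> (x - f) = 0"
    show ?thesis by (rule that[OF F(1)]) (use F(2) in \<open>auto simp: Y_def\<close>)
  qed
  define P where "P x = x - U x" for x
  have P: "bounded_linear P"
    unfolding P_def by (intro bounded_linear_sub bounded_linear_ident U)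
  interpret P: bounded_linear P by (rule P)
  obtain C where C: "\<And>x. norm (P x) \<le> norm x * C" "0 < C"
    using P.pos_bounded by blast
  \<comment> \<open>\<open>P\<close> annihilates \<open>H\<close>, so \<open>P y\<close> is bounded by the distance of \<open>y\<close> to \<open>H\<close>. On \<open>Y\<close> this distance is
    at most twice that of \<open>P y\<close>, as \<open>U\<close> accounts for at most half of it.\<close>
  have "norm (P y) \<le> 2 * C * infdist (P y) H" if "y \<in> Y" for y
  proof -
    have "norm (P y) / C \<le> infdist y H"
    proof (rule infdist_greatest[OF H(1)])
      fix h assume "h \<in> H"
      then have "P y = P (y - h)" by (simp add: P_def U.diff UH)
      then show "norm (P y) / C \<le> norm (y - h)"
        using C(1)[of "y - h"] C(2) by (simp add: field_simps)
    qed
    then have "norm (P y) \<le> C * infdist y H" using C(2) by (simp add: field_simps)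
    moreover have "infdist y H \<le> infdist (P y) H + infdist (U y) H"
      using infdist_add_le[OF H(1), of "P y" "U y"] by (simp add: P_def)
    moreover have "infdist (U y) H \<le> infdist y H / 2"
      using that by (intro \<Phi>(3)) (simp add: Y_def)
    ultimately have "infdist y H \<le> 2 * infdist (P y) H" by linarith
    then have "C * infdist y H \<le> C * (2 * infdist (P y) H)" using C(2) by simp
    then show ?thesis using \<open>norm (P y) \<le> C * infdist y H\<close> by simp
  qed
  then have "transversal H (P ` Y)"
    using P.linear Y by (auto simp: transversal_def linear_subspace_image intro!: exI[of _ "2 * C"])
  then have cl: "transversal H (closure (P ` Y))" by (rule transversal_closure)
  \<comment> \<open>Adding \<open>P ` F\<close> to \<open>P ` Y\<close> gives the whole range of \<open>P\<close>; the unit vectors supply the head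
    \<open>x - c0_tail N x\<close> of every vector.\<close>
  obtain N where N: "\<And>x. infdist (U (c0_tail N x)) H \<le> 1 / 2 * norm x"
    using small[of "1 / 2"] by auto
  have "finite (P ` F \<union> c0_unit ` {..<N})" using F(1) by simp
  then obtain R where R: "transversal H R" "closed R" "closure (P ` Y) \<subseteq> R"
      "P ` F \<union> c0_unit ` {..<N} \<subseteq> subspace_sum R H"
    by (rule transversal_add_finite[OF _ cl closed_closure H])
  define G where "G = subspace_sum R H"
  have subR: "subspace R" using R(1) by (simp add: transversal_def)
  have G: "subspace G" "closed G"
    unfolding G_def using closed_transversal_sum[OF R(1,2) H] subspace_sums[OF subR H(1)] by auto
  have "R \<subseteq> G" unfolding G_def using subspace_0[OF H(1)] by force
  have "H \<subseteq> G" unfolding G_def using subspace_0[OF subR] by force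
  have PG: "P x \<in> G" for x
  proof -
    obtain f where f: "f \<in> span F" "x - f \<in> Y" using F(2) by blast
    have "P (x - f) \<in> G" using f(2) R(3) \<open>R \<subseteq> G\<close> closure_subset by blast
    moreover have "P f \<in> span (P ` F)"
      using f(1) linear_span_image[OF P.linear, of F] by blast
    then have "P f \<in> G" using span_minimal[of "P ` F" G] R(4) G(1) by (auto simp: G_def)
    ultimately have "P (x - f) + P f \<in> G" by (rule subspace_add[OF G(1)])
    then show ?thesis by (simp add: P.diff)
  qed
  have "infdist v G \<le> norm v / 2" for v
  proof -
    have "(\<Sum>i<N. c0_nth v i *\<^sub>R c0_unit i) \<in> G"
      using R(4) by (intro subspace_sum[OF G(1)] subspace_scale[OF G(1)]) (auto simp: G_def)
    then have "v - c0_tail N v + P (c0_tail N v) \<in> G"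
      unfolding c0_head_eq_sum by (intro subspace_add[OF G(1)] PG)
    then have "infdist (v - (v - c0_tail N v + P (c0_tail N v))) G = infdist v G"
      by (rule infdist_minus_subspace[OF G(1)])
    also have "v - (v - c0_tail N v + P (c0_tail N v)) = U (c0_tail N v)"
      by (simp add: P_def)
    finally have "infdist v G = infdist (U (c0_tail N v)) G" by simp
    also have "\<dots> \<le> infdist (U (c0_tail N v)) H"
      using \<open>H \<subseteq> G\<close> subspace_0[OF H(1)] by (intro infdist_mono) auto
    finally show ?thesis using N[of v] by simp
  qed
  then have "G = UNIV" by (rule eq_UNIV_if_infdist_le_half[OF G])
  then have "subspace_sum R H = UNIV" by (simp add: G_def)
  then show ?thesis
    by (rule transversal_sum_UNIV_projection[OF R(1) H(1)]) (rule that)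
qed


section \<open>Complemented subspaces of the space of null sequences\<close>

text \<open>The equation \<open>J x = y\<close> is a fixed-point equation for the contraction \<open>x \<mapsto> y - (J x - x)\<close>.\<close>

lemma near_identity_left_inverse:
  fixes J :: "'a::banach \<Rightarrow> 'a"
  assumes J: "bounded_linear J" and near: "\<And>x. norm (J x - x) \<le> norm x / 2"
  obtains J' where "bounded_linear J'" "\<And>x. J' (J x) = x"
proof -
  interpret J: bounded_linear J by (rule J)
  have below: "norm x \<le> 2 * norm (J x)" for x
    using near[of x] norm_triangle_sub[of x "J x"] by (simp add: norm_minus_commute)
  have "\<exists>x. J x = y" for y
  proof -
    have "\<exists>!x. y - (J x - x) = x"
    proof (rule banach_fix_type[of "1 / 2"])
      show "\<forall>x z. dist (y - (J x - x)) (y - (J z - z)) \<le> 1 / 2 * dist x z"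
      proof (intro allI)
        fix x z
        have "dist (y - (J x - x)) (y - (J z - z)) = norm (J (x - z) - (x - z))"
          by (simp add: dist_norm J.diff norm_minus_commute algebra_simps)
        then show "dist (y - (J x - x)) (y - (J z - z)) \<le> 1 / 2 * dist x z"
          using near[of "x - z"] by (simp add: dist_norm)
      qed
    qed auto
    then show ?thesis by (auto simp: algebra_simps)
  qed
  then obtain J' where J': "\<And>y. J (J' y) = y" by metis
  have inj: "x = z" if "J x = J z" for x z
    using below[of "x - z"] that by (simp add: J.diff)
  show ?thesis
  proof (rule that)
    show "bounded_linear J'"
    proof (rule bounded_linear_intro[of _ 2])
      show "J' (x + y) = J' x + J' y" for x y by (rule inj) (simp add: J' J.add)
      show "J' (r *\<^sub>R x) = r *\<^sub>R J' x" for r x by (rule inj) (simp add: J' J.scaleR)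
      show "norm (J' x) \<le> norm x * 2" for x using below[of "J' x"] by (simp add: J')
    qed
    show "J' (J x) = x" for x by (rule inj) (simp add: J')
  qed
qed

text \<open>Gliding hump. Since there are nonzero fixed points of \<open>e\<close> that vanish on any given initial segment, one
  can choose fixed points \<open>u k\<close> that are almost disjointly supported and take the value one at a
  coordinate \<open>\<nu> k\<close> inside their essential support. Then the unit vectors are sent to \<open>u k\<close> by an
  operator \<open>a\<close>, and reading off the coordinates \<open>\<nu> k\<close> inverts \<open>a\<close> up to a small perturbation.\<close>

lemma complemented_c0_copy:
  fixes e :: "c0 \<Rightarrow> c0"
  assumes e: "bounded_linear e"
    and hump: "\<And>N. \<exists>u. e u = u \<and> u \<noteq> 0 \<and> (\<forall>i<N. c0_nth u i = 0)"
  obtains a b where "bounded_linear a" "bounded_linear (b :: c0 \<Rightarrow> c0)"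
    "\<And>x. e (a x) = a x" "\<And>x. b (a x) = x"
proof -
  interpret e: bounded_linear e by (rule e)
  have "\<exists>v n. e v = v \<and> (\<forall>i<N. c0_nth v i = 0) \<and> c0_nth v n = 1 \<and> norm v \<le> 2" for N
  proof -
    obtain u where u: "e u = u" "u \<noteq> 0" "\<And>i. i < N \<Longrightarrow> c0_nth u i = 0" using hump[of N] by blast
    have "\<exists>n. norm u / 2 < \<bar>c0_nth u n\<bar>"
    proof (rule ccontr)
      assume "\<not> ?thesis"
      then have "norm u \<le> norm u / 2" by (intro norm_c0_le) (auto simp: not_less)
      then show False using u(2) by simp
    qed
    then obtain n where n: "norm u / 2 < \<bar>c0_nth u n\<bar>" by blast
    then have nz: "c0_nth u n \<noteq> 0" using norm_ge_zero[of u] by auto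
    define v where "v = inverse (c0_nth u n) *\<^sub>R u"
    have "norm v \<le> 2" using n nz by (simp add: v_def field_simps)
    moreover have "e v = v" by (simp add: v_def e.scaleR u(1))
    moreover have "c0_nth v n = 1" using nz by (simp add: v_def)
    moreover have "\<forall>i<N. c0_nth v i = 0" using u(3) by (simp add: v_def)
    ultimately show ?thesis by blast
  qed
  then obtain v n where v: "\<And>N. e (v N) = v N" "\<And>N i. i < N \<Longrightarrow> c0_nth (v N) i = 0"
      "\<And>N. c0_nth (v N) (n N) = 1" "\<And>N. norm (v N) \<le> 2"
    by metis
  have "\<forall>k N. \<exists>M. n N < M \<and> (\<forall>i\<ge>M. \<bar>c0_nth (v N) i\<bar> \<le> (1 / 2) ^ (k + 3))"
  proof (intro allI)
    fix k N
    obtain M where M: "\<And>i. i \<ge> M \<Longrightarrow> \<bar>c0_nth (v N) i\<bar> < (1 / 2) ^ (k + 3)"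
      using LIMSEQ_D[OF c0_nth_tendsto_0[of "v N"], of "(1 / 2) ^ (k + 3)"] by auto
    then show "\<exists>M. n N < M \<and> (\<forall>i\<ge>M. \<bar>c0_nth (v N) i\<bar> \<le> (1 / 2) ^ (k + 3))"
      by (intro exI[of _ "max M (Suc (n N))"]) (auto intro: less_imp_le)
  qed
  then obtain M where "\<forall>k N. n N < M k N \<and> (\<forall>i\<ge>M k N. \<bar>c0_nth (v N) i\<bar> \<le> (1 / 2) ^ (k + 3))"
    by metis
  then have M: "\<And>N k. n N < M k N" "\<And>N k i. i \<ge> M k N \<Longrightarrow> \<bar>c0_nth (v N) i\<bar> \<le> (1 / 2) ^ (k + 3)"
    by blast+
  \<comment> \<open>The \<open>k\<close>-th hump starts at \<open>m k\<close>, has its peak before \<open>m (Suc k)\<close> and is negligible from there on.\<close>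
  define m where "m = rec_nat 0 M"
  have m: "m 0 = 0" "m (Suc k) = M k (m k)" for k by (simp_all add: m_def)
  define u where "u k = v (m k)" for k
  define \<nu> where "\<nu> k = n (m k)" for k
  have "m k \<le> \<nu> k" for k
    using v(2)[of "\<nu> k" "m k"] v(3)[of "m k"] by (auto simp: \<nu>_def not_le[symmetric])
  moreover have "\<nu> k < m (Suc k)" for k using M(1) by (simp add: \<nu>_def m)
  ultimately have \<nu>: "m k \<le> \<nu> k" "\<nu> k < m (Suc k)" for k by blast+
  then have m_mono: "strict_mono m" by (auto simp: strict_mono_Suc_iff intro: le_less_trans)
  have \<nu>_mono: "strict_mono \<nu>" using \<nu> by (auto simp: strict_mono_Suc_iff intro: less_le_trans)
  have u_bound: "\<bar>c0_nth (u k) i\<bar> \<le> (1 / 2) ^ (k + 3) + (if k = l then 2 else 0)"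
    if l: "m l \<le> i" "i < m (Suc l)" for k l i
  proof -
    consider "k = l" | "k < l" | "l < k" by linarith
    then show ?thesis
    proof cases
      case 1
      then show ?thesis using abs_c0_nth_le_norm[of "u k" i] v(4)[of "m k"] by (simp add: u_def add_increasing)
    next
      case 2
      then have "m (Suc k) \<le> i" using l(1) strict_mono_less_eq[OF m_mono, of "Suc k" l] by simp
      then show ?thesis using M(2)[of k "m k" i] 2 by (simp add: u_def m)
    next
      case 3
      then have "i < m k" using l(2) strict_mono_less_eq[OF m_mono, of "Suc l" k] by simp
      then show ?thesis using v(2)[of i "m k"] by (simp add: u_def)
    qed
  qed
  have block: "\<exists>l. m l \<le> i \<and> i < m (Suc l)" for i
  proof -
    define l where "l = Max {l. m l \<le> i}"
    have "{l. m l \<le> i} \<subseteq> {..i}" using seq_suble[OF m_mono] by (auto intro: order_trans)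
    then have fin: "finite {l. m l \<le> i}" by (rule finite_subset) simp
    have "l \<in> {l. m l \<le> i}" unfolding l_def using m(1) by (intro Max_in fin) (auto intro: exI[of _ 0])
    moreover have "Suc l \<notin> {l. m l \<le> i}" using Max_ge[OF fin, of "Suc l"] by (auto simp: l_def)
    ultimately show ?thesis by auto
  qed
  have geom: "(\<Sum>k\<in>A. (1 / 2 :: real) ^ (k + 3)) \<le> 1 / 4" if "finite A" for A
  proof -
    have "(\<Sum>k\<in>A. (1 / 2 :: real) ^ k) \<le> (\<Sum>k. (1 / 2) ^ k)"
      using that by (intro sum_le_suminf summable_geometric) auto
    also have "\<dots> = 2" by (simp add: suminf_geometric)
    finally have "(\<Sum>k\<in>A. (1 / 2 :: real) ^ k) * (1 / 8) \<le> 2 * (1 / 8)" by (rule mult_right_mono) simp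
    moreover have "(1 / 2 :: real) ^ (k + 3) = (1 / 2) ^ k * (1 / 8)" for k :: nat
      by (simp add: power_add power3_eq_cube)
    ultimately show ?thesis by (simp only: sum_distrib_right[symmetric])
  qed
  have bound: "norm (\<Sum>k=s..<t. c k *\<^sub>R u k) \<le> 3 * K" if c: "\<And>k. \<bar>c k\<bar> \<le> K" for c s t K
  proof (rule norm_c0_le)
    fix i
    obtain l where l: "m l \<le> i" "i < m (Suc l)" using block by blast
    have "0 \<le> K" using c[of 0] by linarith
    have "\<bar>c0_nth (\<Sum>k=s..<t. c k *\<^sub>R u k) i\<bar> = \<bar>\<Sum>k=s..<t. c k * c0_nth (u k) i\<bar>"
      by (simp add: c0_nth_sum)
    also have "\<dots> \<le> (\<Sum>k=s..<t. \<bar>c k * c0_nth (u k) i\<bar>)" by (rule sum_abs)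
    also have "\<dots> \<le> (\<Sum>k=s..<t. K * ((1 / 2) ^ (k + 3) + (if k = l then 2 else 0)))"
      unfolding abs_mult using \<open>0 \<le> K\<close> by (intro sum_mono mult_mono c u_bound l) auto
    also have "\<dots> = K * ((\<Sum>k=s..<t. (1 / 2) ^ (k + 3)) + (\<Sum>k=s..<t. if k = l then 2 else 0))"
      by (simp only: sum_distrib_left[symmetric] sum.distrib)
    also have "\<dots> \<le> K * (1 / 4 + 2)"
      using \<open>0 \<le> K\<close> by (intro mult_left_mono add_mono geom) auto
    also have "\<dots> \<le> 3 * K" using \<open>0 \<le> K\<close> by simp
    finally show "\<bar>c0_nth (\<Sum>k=s..<t. c k *\<^sub>R u k) i\<bar> \<le> 3 * K" .
  qed
  define a where "a x = (\<Sum>k. c0_nth x k *\<^sub>R u k)" for x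
  have a_sums: "(\<lambda>k. c0_nth x k *\<^sub>R u k) sums a x" for x
    unfolding a_def by (rule c0_synthesis_operator(1)[OF bound])
  have a: "bounded_linear a"
    unfolding a_def[abs_def] by (rule c0_synthesis_operator(2)[OF bound])
  have ea: "e (a x) = a x" for x
    using sums_unique2[OF e.sums[OF a_sums[of x]]] a_sums[of x] v(1) by (simp add: e.scaleR u_def)
  have lim: "(\<lambda>k. c0_nth z (\<nu> k)) \<longlonglongrightarrow> 0" for z
    using LIMSEQ_subseq_LIMSEQ[OF c0_nth_tendsto_0 \<nu>_mono] by (simp add: o_def)
  define b0 where "b0 z = c0_of (\<lambda>k. c0_nth z (\<nu> k))" for z
  have b0: "bounded_linear b0"
    unfolding b0_def[abs_def] by (rule bounded_linear_c0_ofI[of _ 1]) (auto simp: lim abs_c0_nth_le_norm)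
  have near: "norm (b0 (a x) - x) \<le> norm x / 2" for x
  proof (rule norm_c0_le)
    fix j
    have "(\<lambda>t. c0_nth (\<Sum>k<t. c0_nth x k *\<^sub>R u k) (\<nu> j)) \<longlonglongrightarrow> c0_nth (a x) (\<nu> j)"
      using a_sums[of x] unfolding sums_def by (rule bounded_linear.tendsto[OF bounded_linear_c0_nth])
    then have "(\<lambda>t. \<bar>c0_nth (\<Sum>k<t. c0_nth x k *\<^sub>R u k) (\<nu> j) - c0_nth x j\<bar>)
        \<longlonglongrightarrow> \<bar>c0_nth (a x) (\<nu> j) - c0_nth x j\<bar>"
      by (intro tendsto_rabs tendsto_diff tendsto_const)
    moreover have "\<bar>c0_nth (\<Sum>k<t. c0_nth x k *\<^sub>R u k) (\<nu> j) - c0_nth x j\<bar> \<le> norm x / 2" if "t > j" for t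
    proof -
      have "c0_nth (\<Sum>k<t. c0_nth x k *\<^sub>R u k) (\<nu> j) = (\<Sum>k<t. c0_nth x k * c0_nth (u k) (\<nu> j))"
        by (simp add: c0_nth_sum)
      also have "\<dots> = c0_nth x j * c0_nth (u j) (\<nu> j) + (\<Sum>k\<in>{..<t}-{j}. c0_nth x k * c0_nth (u k) (\<nu> j))"
        using that by (intro sum.remove) auto
      finally have "\<bar>c0_nth (\<Sum>k<t. c0_nth x k *\<^sub>R u k) (\<nu> j) - c0_nth x j\<bar>
          = \<bar>\<Sum>k\<in>{..<t}-{j}. c0_nth x k * c0_nth (u k) (\<nu> j)\<bar>"
        using v(3)[of "m j"] by (simp add: u_def \<nu>_def)
      also have "\<dots> \<le> (\<Sum>k\<in>{..<t}-{j}. \<bar>c0_nth x k * c0_nth (u k) (\<nu> j)\<bar>)" by (rule sum_abs)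
      also have "\<dots> \<le> (\<Sum>k\<in>{..<t}-{j}. norm x * (1 / 2) ^ (k + 3))"
        unfolding abs_mult using u_bound[OF \<nu>]
        by (intro sum_mono mult_mono abs_c0_nth_le_norm) (force split: if_splits)+
      also have "\<dots> = norm x * (\<Sum>k\<in>{..<t}-{j}. (1 / 2) ^ (k + 3))" by (simp only: sum_distrib_left)
      also have "\<dots> \<le> norm x * (1 / 4)" by (intro mult_left_mono geom) auto
      also have "\<dots> \<le> norm x / 2" by simp
      finally show ?thesis .
    qed
    then have "\<exists>N. \<forall>t\<ge>N. \<bar>c0_nth (\<Sum>k<t. c0_nth x k *\<^sub>R u k) (\<nu> j) - c0_nth x j\<bar> \<le> norm x / 2"
      by (intro exI[of _ "Suc j"]) auto
    ultimately have "\<bar>c0_nth (a x) (\<nu> j) - c0_nth x j\<bar> \<le> norm x / 2" by (rule LIMSEQ_le_const2)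
    then show "\<bar>c0_nth (b0 (a x) - x) j\<bar> \<le> norm x / 2"
      by (simp add: b0_def c0_nth_c0_of[OF lim])
  qed
  obtain J' where J': "bounded_linear J'" "\<And>x. J' (b0 (a x)) = x"
    using near_identity_left_inverse[OF bounded_linear_compose[OF b0 a] near] by blast
  show ?thesis
    using that[OF a bounded_linear_compose[OF J'(1) b0] ea] J'(2) by blast
qed

text \<open>The pairing bijection identifies a null sequence with the sequence of its rows, which is an
  arbitrary sequence of null sequences whose norms tend to zero: \<open>c0\<close> is the \<open>c0\<close>-sum of countably
  many copies of itself.\<close>

definition c0_row :: "nat \<Rightarrow> c0 \<Rightarrow> c0" where
  "c0_row k x = c0_of (\<lambda>n. c0_nth x (prod_encode (k, n)))"

definition c0_of_rows :: "(nat \<Rightarrow> c0) \<Rightarrow> c0" where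
  "c0_of_rows y = c0_of (\<lambda>i. c0_nth (y (fst (prod_decode i))) (snd (prod_decode i)))"

lemma c0_nth_row: "c0_nth (c0_row k x) n = c0_nth x (prod_encode (k, n))"
proof -
  have "filterlim (\<lambda>n. prod_encode (k, n)) sequentially sequentially"
    by (rule filterlim_at_top_mono[OF filterlim_ident]) (simp add: le_prod_encode_2)
  then have "(\<lambda>n. c0_nth x (prod_encode (k, n))) \<longlonglongrightarrow> 0"
    by (rule filterlim_compose[OF c0_nth_tendsto_0])
  then show ?thesis by (simp add: c0_row_def c0_nth_c0_of)
qed

lemma norm_c0_row_le: "norm (c0_row k x) \<le> norm x"
  by (rule norm_c0_le) (simp add: c0_nth_row abs_c0_nth_le_norm)

lemma bounded_linear_c0_row: "bounded_linear (c0_row k)"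
  by (rule bounded_linear_intro[of _ 1]) (auto intro!: c0_eqI simp: c0_nth_row norm_c0_row_le)

lemma c0_row_tendsto_0: "(\<lambda>k. c0_row k x) \<longlonglongrightarrow> 0"
proof (rule LIMSEQ_I)
  fix e :: real assume "0 < e"
  then obtain M where M: "\<And>n. n \<ge> M \<Longrightarrow> \<bar>c0_nth x n\<bar> < e / 2"
    using LIMSEQ_D[OF c0_nth_tendsto_0[of x], of "e/2"] by auto
  have "norm (c0_row k x - 0) < e" if "k \<ge> M" for k
  proof -
    have "norm (c0_row k x) \<le> e / 2"
    proof (rule norm_c0_le)
      fix n
      have "M \<le> prod_encode (k, n)" using le_prod_encode_1[of k n] that by linarith
      then show "\<bar>c0_nth (c0_row k x) n\<bar> \<le> e / 2" using M[of "prod_encode (k, n)"] by (simp add: c0_nth_row)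
    qed
    then show ?thesis using \<open>0 < e\<close> by simp
  qed
  then show "\<exists>M. \<forall>k\<ge>M. norm (c0_row k x - 0) < e" by blast
qed

lemma rows_seq_tendsto_0:
  assumes "y \<longlonglongrightarrow> 0"
  shows "(\<lambda>i. c0_nth (y (fst (prod_decode i))) (snd (prod_decode i))) \<longlonglongrightarrow> 0"
proof (rule LIMSEQ_I)
  fix e :: real assume "0 < e"
  obtain K where K: "\<And>k. k \<ge> K \<Longrightarrow> norm (y k) < e"
    using LIMSEQ_D[OF assms \<open>0 < e\<close>] by auto
  have "\<exists>N. \<forall>n\<ge>N. \<bar>c0_nth (y k) n\<bar> < e" for k
    using LIMSEQ_D[OF c0_nth_tendsto_0[of "y k"] \<open>0 < e\<close>] by auto
  then obtain N where N: "\<And>k n. n \<ge> N k \<Longrightarrow> \<bar>c0_nth (y k) n\<bar> < e" by metis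
  have "finite (prod_encode ` (SIGMA k:{..<K}. {..<N k}))"
    by (intro finite_imageI finite_SigmaI) auto
  then obtain B where B: "\<forall>i\<in>prod_encode ` (SIGMA k:{..<K}. {..<N k}). i < B"
    unfolding finite_nat_set_iff_bounded by (elim exE)
  have "\<bar>c0_nth (y (fst (prod_decode i))) (snd (prod_decode i))\<bar> < e" if "i \<ge> B" for i
  proof -
    obtain k n where kn: "prod_decode i = (k, n)" by (cases "prod_decode i") auto
    then have i: "i = prod_encode (k, n)" by (metis prod_decode_inverse)
    have "(k, n) \<notin> (SIGMA k:{..<K}. {..<N k})" using B that unfolding i by (meson imageI not_le)
    then consider "k \<ge> K" | "n \<ge> N k" by (meson SigmaI lessThan_iff not_le)
    then show ?thesis
    proof cases
      case 1
      then show ?thesis using K[of k] abs_c0_nth_le_norm[of "y k" n] kn by simp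
    next
      case 2
      then show ?thesis using N[of k n] kn by simp
    qed
  qed
  then show "\<exists>B. \<forall>i\<ge>B. norm (c0_nth (y (fst (prod_decode i))) (snd (prod_decode i)) - 0) < e"
    by auto
qed

lemma c0_row_of_rows: "y \<longlonglongrightarrow> 0 \<Longrightarrow> c0_row k (c0_of_rows y) = y k"
  by (rule c0_eqI) (simp add: c0_nth_row c0_of_rows_def c0_nth_c0_of rows_seq_tendsto_0)

lemma c0_of_rows_row: "c0_of_rows (\<lambda>k. c0_row k x) = x"
  by (rule c0_eqI)
    (simp add: c0_of_rows_def c0_nth_c0_of rows_seq_tendsto_0[OF c0_row_tendsto_0] c0_nth_row c0_nth_tendsto_0)

lemma bounded_linear_c0_of_rows:
  fixes D :: "nat \<Rightarrow> 'a::real_normed_vector \<Rightarrow> c0"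
  assumes lin: "\<And>k. linear (D k)" and lim: "\<And>z. (\<lambda>k. D k z) \<longlonglongrightarrow> 0"
    and bound: "\<And>k z. norm (D k z) \<le> K * norm z"
  shows "bounded_linear (\<lambda>z. c0_of_rows (\<lambda>k. D k z))"
  unfolding c0_of_rows_def
proof (rule bounded_linear_c0_ofI[of _ K])
  show "\<bar>c0_nth (D (fst (prod_decode i)) z) (snd (prod_decode i))\<bar> \<le> K * norm z" for z i
    using bound abs_c0_nth_le_norm by (rule order_trans[rotated])
qed (simp_all add: rows_seq_tendsto_0[OF lim] linear_add[OF lin] linear_cmul[OF lin])


text \<open>Pelczynski's decomposition method, written out. With \<open>A = range e\<close> and \<open>f x = x - e x\<close>, a vector
  \<open>z \<in> A\<close> is encoded by the rows of \<open>b z\<close> and the remainder \<open>w = z - a (b z)\<close>. Row zero and \<open>w\<close>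
  recombine to an element \<open>\<alpha>\<close> of \<open>A\<close>, and the other rows are split into their components in \<open>A\<close> and in
  the kernel of \<open>e\<close>; shifting the kernel components by one place makes room for \<open>\<alpha>\<close> in the sequence of
  components in \<open>A\<close>.\<close>

theorem complemented_subspace_isomorphic_c0:
  fixes e :: "c0 \<Rightarrow> c0"
  assumes e: "bounded_linear e" and idem: "\<And>x. e (e x) = e x"
    and hump: "\<And>N. \<exists>u. e u = u \<and> u \<noteq> 0 \<and> (\<forall>i<N. c0_nth u i = 0)"
  obtains s t :: "c0 \<Rightarrow> c0" where "bounded_linear s" "bounded_linear t"
    "\<And>d. t (s d) = d" "\<And>x. s (t x) = e x"
proof -
  obtain a b where a: "bounded_linear a" and b: "bounded_linear (b :: c0 \<Rightarrow> c0)"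
    and ea: "\<And>x. e (a x) = a x" and ba: "\<And>x. b (a x) = x"
    using complemented_c0_copy[OF e hump] by metis
  define f where "f x = x - e x" for x
  have f: "bounded_linear f" unfolding f_def by (intro bounded_linear_sub bounded_linear_ident e)
  interpret e: bounded_linear e by (rule e)
  interpret a: bounded_linear a by (rule a)
  interpret b: bounded_linear b by (rule b)
  interpret f: bounded_linear f by (rule f)
  have ef: "e (f x) = 0" and fe: "f (e x) = 0" and ff: "f (f x) = f x" and fa: "f (a x) = 0" for x
    by (simp_all add: f_def e.diff idem ea)

  define c where "c z = b (e z)" for z
  define w where "w z = e z - a (c z)" for z
  define y where "y z k = c0_row k (c z)" for z k
  define D where "D k z = (case k of 0 \<Rightarrow> a (y z 0) + w z + f (y z 1)
      | Suc j \<Rightarrow> e (y z (Suc j)) + f (y z (Suc (Suc j))))" for k z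
  have c: "bounded_linear c" unfolding c_def by (rule bounded_linear_compose[OF b e])
  have y: "bounded_linear (\<lambda>z. y z k)" for k
    unfolding y_def by (rule bounded_linear_compose[OF bounded_linear_c0_row c])
  have w: "bounded_linear w"
    unfolding w_def by (intro bounded_linear_sub e bounded_linear_compose[OF a c])
  have ew: "e (w z) = w z" and bw: "b (w z) = 0" and fw: "f (w z) = 0" for z
    by (simp_all add: w_def f_def e.diff b.diff idem ea ba c_def)
  have D0: "bounded_linear (D 0)"
    unfolding D_def by (simp, intro bounded_linear_add w bounded_linear_compose[OF a y] bounded_linear_compose[OF f y])
  have D_Suc: "bounded_linear (D (Suc j))" for j
    unfolding D_def by (simp, intro bounded_linear_add bounded_linear_compose[OF e y] bounded_linear_compose[OF f y])
  obtain K0 where K0: "\<And>z. norm (D 0 z) \<le> norm z * K0"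
    using bounded_linear.bounded[OF D0] by blast
  obtain Ke Kf Kc where Ke: "\<And>z. norm (e z) \<le> norm z * Ke" "0 \<le> Ke"
    and Kf: "\<And>z. norm (f z) \<le> norm z * Kf" "0 \<le> Kf" and Kc: "\<And>z. norm (c z) \<le> norm z * Kc"
    using e.nonneg_bounded f.nonneg_bounded bounded_linear.nonneg_bounded[OF c] by metis
  have D_bound: "norm (D k z) \<le> max K0 (Kc * (Ke + Kf)) * norm z" for k z
  proof (cases k)
    case 0
    have "norm z * K0 \<le> norm z * max K0 (Kc * (Ke + Kf))" by (intro mult_left_mono) auto
    then show ?thesis using K0[of z] 0 by (simp add: mult.commute)
  next
    case (Suc j)
    have row: "norm (y z i) \<le> norm z * Kc" for i
      unfolding y_def using norm_c0_row_le Kc by (rule order_trans)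
    have "norm (D k z) \<le> norm (e (y z (Suc j))) + norm (f (y z (Suc (Suc j))))"
      by (simp add: Suc D_def norm_triangle_ineq)
    also have "\<dots> \<le> norm (y z (Suc j)) * Ke + norm (y z (Suc (Suc j))) * Kf"
      by (intro add_mono Ke Kf)
    also have "\<dots> \<le> (norm z * Kc) * Ke + (norm z * Kc) * Kf"
      by (intro add_mono mult_right_mono row Ke Kf)
    also have "\<dots> = norm z * (Kc * (Ke + Kf))" by (simp add: algebra_simps)
    also have "\<dots> \<le> norm z * max K0 (Kc * (Ke + Kf))" by (intro mult_left_mono) auto
    finally show ?thesis by (simp add: mult.commute)
  qed
  have D_lim: "(\<lambda>k. D k z) \<longlonglongrightarrow> 0" for z
  proof -
    have y_lim: "(\<lambda>k. y z k) \<longlonglongrightarrow> 0" unfolding y_def by (rule c0_row_tendsto_0)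
    have "(\<lambda>j. e (y z (Suc j)) + f (y z (Suc (Suc j)))) \<longlonglongrightarrow> 0 + 0"
      by (intro tendsto_add e.tendsto_zero f.tendsto_zero LIMSEQ_Suc[OF y_lim] LIMSEQ_Suc[OF LIMSEQ_Suc[OF y_lim]])
    then have "(\<lambda>j. D (Suc j) z) \<longlonglongrightarrow> 0" by (simp add: D_def)
    then show ?thesis by (rule LIMSEQ_imp_Suc)
  qed
  define t where "t z = c0_of_rows (\<lambda>k. D k z)" for z
  have t: "bounded_linear t"
    unfolding t_def
  proof (rule bounded_linear_c0_of_rows[OF _ D_lim D_bound])
    show "linear (D k)" for k
      by (cases k) (auto intro: bounded_linear.linear D0 D_Suc)
  qed
  have row_t: "c0_row k (t z) = D k z" for k z
    unfolding t_def by (rule c0_row_of_rows[OF D_lim])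

  \<comment> \<open>The inverse: \<open>\<alpha>\<close> is the component of row zero in \<open>A\<close>, and \<open>Y k\<close> are the rows of \<open>b z\<close>, where
    \<open>b\<close> recovers row zero from \<open>\<alpha>\<close> because it annihilates \<open>w\<close>.\<close>
  define \<alpha> where "\<alpha> d = e (c0_row 0 d)" for d
  define Y where "Y k d = (case k of 0 \<Rightarrow> b (\<alpha> d) | Suc j \<Rightarrow> f (c0_row j d) + e (c0_row (Suc j) d))" for k d
  define s where "s d = a (c0_of_rows (\<lambda>k. Y k d)) + (\<alpha> d - a (Y 0 d))" for d
  have \<alpha>: "bounded_linear \<alpha>" unfolding \<alpha>_def by (rule bounded_linear_compose[OF e bounded_linear_c0_row])
  have Y0: "bounded_linear (Y 0)" unfolding Y_def by (simp, rule bounded_linear_compose[OF b \<alpha>])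
  have Y_Suc: "bounded_linear (Y (Suc j))" for j
    unfolding Y_def by (simp, intro bounded_linear_add bounded_linear_compose[OF e bounded_linear_c0_row]
      bounded_linear_compose[OF f bounded_linear_c0_row])
  obtain L0 where L0: "\<And>d. norm (Y 0 d) \<le> norm d * L0"
    using bounded_linear.bounded[OF Y0] by blast
  have Y_bound: "norm (Y k d) \<le> max L0 (Ke + Kf) * norm d" for k d
  proof (cases k)
    case 0
    have "norm d * L0 \<le> norm d * max L0 (Ke + Kf)" by (intro mult_left_mono) auto
    then show ?thesis using L0[of d] 0 by (simp add: mult.commute)
  next
    case (Suc j)
    have "norm (Y k d) \<le> norm (f (c0_row j d)) + norm (e (c0_row (Suc j) d))"
      by (simp add: Suc Y_def norm_triangle_ineq)
    also have "\<dots> \<le> norm (c0_row j d) * Kf + norm (c0_row (Suc j) d) * Ke"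
      by (intro add_mono Ke Kf)
    also have "\<dots> \<le> norm d * Kf + norm d * Ke"
      by (intro add_mono mult_right_mono norm_c0_row_le Ke Kf)
    also have "\<dots> = norm d * (Ke + Kf)" by (simp add: algebra_simps)
    also have "\<dots> \<le> norm d * max L0 (Ke + Kf)" by (intro mult_left_mono) auto
    finally show ?thesis by (simp add: mult.commute)
  qed
  have Y_lim: "(\<lambda>k. Y k d) \<longlonglongrightarrow> 0" for d
  proof -
    have "(\<lambda>j. f (c0_row j d) + e (c0_row (Suc j) d)) \<longlonglongrightarrow> 0 + 0"
      by (intro tendsto_add e.tendsto_zero f.tendsto_zero c0_row_tendsto_0 LIMSEQ_Suc[OF c0_row_tendsto_0])
    then have "(\<lambda>j. Y (Suc j) d) \<longlonglongrightarrow> 0" by (simp add: Y_def)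
    then show ?thesis by (rule LIMSEQ_imp_Suc)
  qed
  have rows: "bounded_linear (\<lambda>d. c0_of_rows (\<lambda>k. Y k d))"
  proof (rule bounded_linear_c0_of_rows[OF _ Y_lim Y_bound])
    show "linear (Y k)" for k
      by (cases k) (auto intro: bounded_linear.linear Y0 Y_Suc)
  qed
  have s: "bounded_linear s"
    unfolding s_def by (intro bounded_linear_add bounded_linear_sub \<alpha> bounded_linear_compose[OF a rows]
      bounded_linear_compose[OF a Y0])

  have "s (t x) = e x" for x
  proof -
    have \<alpha>_t: "\<alpha> (t x) = a (y x 0) + w x"
      by (simp add: \<alpha>_def row_t D_def e.add ea ew ef)
    have "Y k (t x) = y x k" for k
    proof (cases k)
      case 0
      then show ?thesis by (simp add: Y_def \<alpha>_t b.add ba bw)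
    next
      case (Suc j)
      have "f (D j x) = f (y x (Suc j))"
        by (cases j) (simp_all add: D_def f.add fa fw ff fe)
      moreover have "e (D (Suc j) x) = e (y x (Suc j))"
        by (simp add: D_def e.add idem ef)
      ultimately show ?thesis by (simp add: Suc Y_def row_t) (simp add: f_def)
    qed
    then have "s (t x) = a (c0_of_rows (y x)) + (a (y x 0) + w x - a (y x 0))"
      by (simp add: s_def \<alpha>_t)
    also have "c0_of_rows (y x) = c x" unfolding y_def by (rule c0_of_rows_row)
    finally show ?thesis by (simp add: w_def)
  qed
  moreover have "t (s d) = d" for d
  proof -
    have e\<alpha>: "e (\<alpha> d) = \<alpha> d" by (simp add: \<alpha>_def idem)
    have "e (s d) = s d" by (simp add: s_def e.add e.diff ea e\<alpha>)
    then have c_s: "c (s d) = c0_of_rows (\<lambda>k. Y k d)"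
      by (simp add: c_def) (simp add: s_def b.add b.diff ba Y_def)
    have y_s: "y (s d) k = Y k d" for k
      unfolding y_def c_s by (rule c0_row_of_rows[OF Y_lim])
    have w_s: "w (s d) = \<alpha> d - a (Y 0 d)"
      using \<open>e (s d) = s d\<close> by (simp add: w_def c_s) (simp add: s_def)
    have "D k (s d) = c0_row k d" for k
    proof (cases k)
      case 0
      have "D 0 (s d) = \<alpha> d + f (Y 1 d)" by (simp add: D_def y_s w_s)
      also have "f (Y 1 d) = f (c0_row 0 d)" by (simp add: Y_def f.add ff fe)
      finally show ?thesis by (simp add: 0 \<alpha>_def f_def)
    next
      case (Suc j)
      have "D (Suc j) (s d) = e (Y (Suc j) d) + f (Y (Suc (Suc j)) d)" by (simp add: D_def y_s)
      also have "\<dots> = e (c0_row (Suc j) d) + f (c0_row (Suc j) d)"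
        by (simp add: Y_def e.add f.add idem ef ff fe)
      finally show ?thesis by (simp add: Suc f_def)
    qed
    then show ?thesis by (simp add: t_def c0_of_rows_row)
  qed
  ultimately show ?thesis using that s t by blast
qed


section \<open>Operators into quotients with the Schur property\<close>

text \<open>Otherwise there are unit vectors \<open>u n\<close> such that the vectors \<open>z n = T (c0_tail n (u n))\<close> stay away
  from \<open>M\<close>. But a functional on the quotient by \<open>M\<close>, composed with \<open>T\<close>, is a functional on \<open>c0\<close> and
  hence small on tails, so that \<open>z n\<close> is weakly null modulo \<open>M\<close>.\<close>

lemma schur_quotient_small_on_tails:
  fixes T :: "c0 \<Rightarrow> 'e::real_normed_vector"
  assumes M: "subspace M" and schur: "quotient_schur M" and T: "bounded_linear T" and "0 < e"
  shows "\<exists>N. \<forall>x. infdist (T (c0_tail N x)) M \<le> e * norm x"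
proof (rule ccontr)
  interpret T: bounded_linear T by (rule T)
  assume "\<not> ?thesis"
  then have "\<forall>N. \<exists>x. e * norm x < infdist (T (c0_tail N x)) M" by (meson not_le)
  then obtain x where x: "\<And>N. e * norm (x N) < infdist (T (c0_tail N (x N))) M" by metis
  define z where "z N = T (c0_tail N (inverse (norm (x N)) *\<^sub>R x N))" for N
  have big: "e < infdist (z N) M" for N
  proof -
    have "x N \<noteq> 0"
    proof
      assume "x N = 0"
      then have "c0_tail N (x N) = 0" by (auto intro!: c0_eqI)
      then show False using x[of N] \<open>x N = 0\<close> subspace_0[OF M] by simp
    qed
    moreover have "z N = inverse (norm (x N)) *\<^sub>R T (c0_tail N (x N))"
      unfolding z_def by (simp add: linear_cmul[OF bounded_linear.linear[OF bounded_linear_c0_tail]] T.scaleR)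
    ultimately show ?thesis
      using x[of N] by (simp add: infdist_scaleR[OF M] field_simps)
  qed
  have "(\<lambda>n. quotient_norm (coset M (z n - 0))) \<longlonglongrightarrow> 0"
  proof (rule schur[unfolded quotient_schur_def, rule_format])
    fix \<phi> :: "'e set \<Rightarrow> real" assume \<phi>: "quotient_operator M \<phi>"
    obtain K where K: "\<And>v. \<bar>\<phi> (coset M v)\<bar> \<le> K * infdist v M"
      using \<phi> by (auto simp: quotient_operator_def quotient_norm_coset[OF M])
    have "bounded_linear (\<lambda>v. \<phi> (coset M v))"
    proof (rule bounded_linear_intro[of _ "\<bar>K\<bar>"])
      show "norm (\<phi> (coset M v)) \<le> norm v * \<bar>K\<bar>" for v
      proof -
        have "K * infdist v M \<le> \<bar>K\<bar> * norm v"
          using infdist_le_norm[OF M] by (intro mult_mono) (auto simp: infdist_nonneg)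
        then show ?thesis using K[of v] by (simp add: mult.commute)
      qed
    qed (use \<phi> in \<open>auto simp: quotient_operator_def\<close>)
    then have g: "bounded_linear (\<lambda>u. \<phi> (coset M (T u)))"
      by (rule bounded_linear_compose[OF _ T])
    have "(\<lambda>n. \<phi> (coset M (z n))) \<longlonglongrightarrow> 0"
    proof (rule LIMSEQ_I)
      fix r :: real assume "0 < r"
      then obtain N where N: "\<And>n u. n \<ge> N \<Longrightarrow> \<bar>\<phi> (coset M (T (c0_tail n u)))\<bar> \<le> r / 2 * norm u"
        using c0_functional_small_on_tail[OF g, of "r / 2"] by auto
      have "norm (\<phi> (coset M (z n)) - 0) < r" if "n \<ge> N" for n
      proof -
        define u where "u = inverse (norm (x n)) *\<^sub>R x n"
        have "norm u \<le> 1" by (simp add: u_def field_simps)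
        then have "r / 2 * norm u \<le> r / 2 * 1" using \<open>0 < r\<close> by (intro mult_left_mono) auto
        moreover have "\<bar>\<phi> (coset M (z n))\<bar> \<le> r / 2 * norm u"
          unfolding z_def u_def[symmetric] by (rule N[OF that])
        ultimately have "\<bar>\<phi> (coset M (z n))\<bar> \<le> r / 2 * 1" by linarith
        then show ?thesis using \<open>0 < r\<close> by simp
      qed
      then show "\<exists>N. \<forall>n\<ge>N. norm (\<phi> (coset M (z n)) - 0) < r" by blast
    qed
    moreover have "\<phi> (coset M 0) = 0" using K[of 0] subspace_0[OF M] by simp
    ultimately show "(\<lambda>n. \<phi> (coset M (z n))) \<longlonglongrightarrow> \<phi> (coset M 0)" by simp
  qed
  then have "(\<lambda>n. infdist (z n) M) \<longlonglongrightarrow> 0" by (simp add: quotient_norm_coset[OF M])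
  then have "e \<le> 0" using big by (intro LIMSEQ_le_const) (auto intro: less_imp_le)
  then show False using \<open>0 < e\<close> by simp
qed

section \<open>Quotients of the space of null sequences\<close>

lemma coset_eq_iff:
  assumes M: "subspace M"
  shows "coset M x = coset M y \<longleftrightarrow> x - y \<in> M"
proof
  assume "coset M x = coset M y"
  moreover have "x \<in> coset M x" unfolding coset_def using subspace_0[OF M] by force
  ultimately have "x \<in> coset M y" by simp
  then show "x - y \<in> M" unfolding coset_def by auto
next
  have sub: "coset M u \<subseteq> coset M v" if "u - v \<in> M" for u v
  proof
    fix z assume "z \<in> coset M u"
    then obtain h where h: "h \<in> M" "z = u + h" unfolding coset_def by blast
    then have "z = v + (u - v + h)" by simp
    then show "z \<in> coset M v" unfolding coset_def using subspace_add[OF M that h(1)] by blast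
  qed
  assume "x - y \<in> M"
  moreover from this have "y - x \<in> M" using subspace_neg[OF M] by fastforce
  ultimately show "coset M x = coset M y" using sub by blast
qed

text \<open>A surjection \<open>t\<close> with kernel \<open>H\<close> induces the isomorphism, and its right inverse \<open>s\<close> provides
  representatives that are controlled by the image.\<close>

lemma quotient_isomorphicI:
  fixes H :: "'a::real_normed_vector set" and t :: "'a \<Rightarrow> 'b::real_normed_vector"
  assumes H: "subspace H" and t: "bounded_linear t" and s: "bounded_linear s"
    and kernel: "\<And>h. h \<in> H \<Longrightarrow> t h = 0" and surj: "\<And>d. t (s d) = d"
    and lift: "\<And>x. x - s (t x) \<in> H"
  shows "quotient_isomorphic H TYPE('b)"
proof -
  interpret t: bounded_linear t by (rule t)
  interpret s: bounded_linear s by (rule s)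
  define \<tau> where "\<tau> C = t (SOME x. C = coset H x)" for C
  have \<tau>: "\<tau> (coset H x) = t x" for x
  proof -
    have "coset H x = coset H (SOME z. coset H x = coset H z)" by (rule someI) simp
    then have "x - (SOME z. coset H x = coset H z) \<in> H" by (simp only: coset_eq_iff[OF H])
    then show ?thesis using kernel t.diff unfolding \<tau>_def by fastforce
  qed
  obtain Kt where Kt: "\<And>x. norm (t x) \<le> norm x * Kt" "0 < Kt" using t.pos_bounded by blast
  obtain Ks where Ks: "\<And>d. norm (s d) \<le> norm d * Ks" using s.bounded by blast
  have "norm (t x) \<le> Kt * infdist x H" for x
  proof -
    have "norm (t x) / Kt \<le> infdist x H"
    proof (rule infdist_greatest[OF H])
      fix h assume "h \<in> H"
      then have "t x = t (x - h)" by (simp add: t.diff kernel)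
      then show "norm (t x) / Kt \<le> norm (x - h)" using Kt(1)[of "x - h"] Kt(2) by (simp add: field_simps)
    qed
    then show ?thesis using Kt(2) by (simp add: field_simps)
  qed
  then have "quotient_operator H \<tau>"
    unfolding quotient_operator_def \<tau> quotient_norm_coset[OF H] by (auto simp: t.add t.scaleR)
  moreover have "bij_betw \<tau> (range (coset H)) UNIV"
    unfolding bij_betw_def
  proof
    show "inj_on \<tau> (range (coset H))"
    proof (rule inj_onI, clarsimp simp: \<tau>)
      fix x y assume "t x = t y"
      then have "(x - s (t x)) - (y - s (t y)) = x - y" by simp
      then have "x - y \<in> H" using subspace_diff[OF H lift lift] by metis
      then show "coset H x = coset H y" by (simp add: coset_eq_iff[OF H])
    qed
    show "\<tau> ` range (coset H) = UNIV"
      using surj \<tau> by (metis UNIV_eq_I rangeI imageI)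
  qed
  moreover have "infdist x H \<le> Ks * norm (t x)" for x
  proof -
    have "infdist x H = infdist (s (t x)) H"
      using infdist_minus_subspace[OF H lift[of x], of x] by simp
    also have "\<dots> \<le> norm (s (t x))" by (rule infdist_le_norm[OF H])
    finally show ?thesis using Ks[of "t x"] by (simp add: mult.commute)
  qed
  ultimately show ?thesis
    unfolding quotient_isomorphic_def by (intro exI[of _ \<tau>] conjI exI[of _ Ks]) (auto simp: \<tau> quotient_norm_coset[OF H])
qed

text \<open>The projection \<open>p\<close> has kernel \<open>H\<close> and so identifies the quotient with its range.\<close>

lemma complemented_quotient_dichotomy:
  fixes H :: "c0 set"
  assumes H: "subspace H" and p: "bounded_linear p"
    and lift: "\<And>x. x - p x \<in> H" and kernel: "\<And>h. h \<in> H \<Longrightarrow> p h = 0"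
  shows "quotient_finite_dim H \<or> quotient_isomorphic H TYPE(c0)"
proof (cases "quotient_finite_dim H")
  case True
  then show ?thesis by blast
next
  case inf: False
  interpret p: bounded_linear p by (rule p)
  have idem: "p (p x) = p x" for x
    using kernel[OF lift[of x]] by (simp add: p.diff)
  \<comment> \<open>If the projection had no nonzero fixed point vanishing on the first \<open>N\<close> coordinates, then its range
    would be determined by these coordinates and have finite dimension.\<close>
  have "\<exists>u. p u = u \<and> u \<noteq> 0 \<and> (\<forall>i<N. c0_nth u i = 0)" for N
  proof (rule ccontr)
    assume none: "\<not> ?thesis"
    have "subspace (range p)" using linear_subspace_image[OF p.linear subspace_UNIV] .
    obtain F where F: "finite F" "F \<subseteq> range p"
      "\<And>x. x \<in> range p \<Longrightarrow> \<exists>f\<in>span F. \<forall>\<phi>\<in>(\<lambda>i x. c0_nth x i) ` {..<N}. \<phi> (x - f) = 0"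
    proof (rule finitely_many_functionals_finite_codim[of "(\<lambda>i x. c0_nth x i) ` {..<N}", OF _ \<open>subspace (range p)\<close>])
      show "finite ((\<lambda>i x. c0_nth x i) ` {..<N})" by simp
      show "linear \<phi>" if "\<phi> \<in> (\<lambda>i x. c0_nth x i) ` {..<N}" for \<phi>
        using that bounded_linear.linear[OF bounded_linear_c0_nth] by (elim imageE) simp
    qed blast
    have span: "span F \<subseteq> range p" using span_minimal[OF F(2)] \<open>subspace (range p)\<close> by blast
    have "p x \<in> span F" for x
    proof -
      obtain f where f: "f \<in> span F" "\<forall>i<N. c0_nth (p x - f) i = 0" using F(3)[of "p x"] by auto
      have "p f = f" using f(1) span idem by auto
      then have "p (p x - f) = p x - f" by (simp add: p.diff idem)
      then have "p x - f = 0" using none f(2) by blast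
      then show ?thesis using f(1) by simp
    qed
    moreover have "coset H x = coset H (p x)" for x using lift[of x] by (simp add: coset_eq_iff[OF H])
    ultimately have "range (coset H) = coset H ` span F" by blast
    then show False using inf F(1) unfolding quotient_finite_dim_def by blast
  qed
  then obtain s t :: "c0 \<Rightarrow> c0" where st: "bounded_linear s" "bounded_linear t" "\<And>d. t (s d) = d" "\<And>x. s (t x) = p x"
    by (rule complemented_subspace_isomorphic_c0[OF p idem]) (rule that)
  have "t h = 0" if "h \<in> H" for h
  proof -
    have "t h = t (s (t h))" by (simp add: st(3))
    also have "\<dots> = 0" using kernel[OF that] by (simp add: st(4) linear_0[OF bounded_linear.linear[OF st(2)]])
    finally show ?thesis .
  qed
  then have "quotient_isomorphic H TYPE(c0)"
    using lift by (intro quotient_isomorphicI[OF H st(2,1)]) (auto simp: st)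
  then show ?thesis by blast
qed

theorem proposition3p2:
  fixes H :: "c0 set" and j :: "c0 \<Rightarrow> 'e::banach"
  assumes "subspace H" and "closed H"
    and "\<not> quotient_finite_dim H"
    and "\<not> quotient_isomorphic H TYPE(c0)"
    and "bourgain_pisier H j"
  shows "\<not> LP_space TYPE('e)"
proof
  assume LP: "LP_space TYPE('e)"
  define M where "M = j ` H"
  have "isomorphism_on H M j" and sep: "separable_space (euclidean :: 'e topology)"
    and schur: "quotient_schur M"
    using assms(5) by (auto simp: bourgain_pisier_def embedding_on_def M_def)
  then have j: "operator_on H j" "inj_on j H" and j_inv: "operator_on M (inv_into H j)"
    by (auto simp: isomorphism_on_def bij_betw_def)
  have M: "subspace M"
  proof (rule subspaceI)
    have "j (0 *\<^sub>R 0) = 0 *\<^sub>R j 0" using j(1) subspace_0[OF assms(1)] unfolding operator_on_def by blast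
    then show "0 \<in> M" unfolding M_def using subspace_0[OF assms(1)] by (intro image_eqI[of _ _ 0]) simp_all
    show "x + y \<in> M" if xy: "x \<in> M" "y \<in> M" for x y
    proof -
      obtain h k where "h \<in> H" "k \<in> H" "x = j h" "y = j k" using xy by (auto simp: M_def)
      then have "x + y = j (h + k)" using j(1) by (simp add: operator_on_def)
      then show ?thesis using subspace_add[OF assms(1) \<open>h \<in> H\<close> \<open>k \<in> H\<close>] by (simp add: M_def)
    qed
    show "r *\<^sub>R x \<in> M" if "x \<in> M" for r x
    proof -
      obtain h where "h \<in> H" "x = j h" using \<open>x \<in> M\<close> by (auto simp: M_def)
      then have "r *\<^sub>R x = j (r *\<^sub>R h)" using j(1) by (simp add: operator_on_def)
      then show ?thesis using subspace_scale[OF assms(1) \<open>h \<in> H\<close>] by (simp add: M_def)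
    qed
  qed
  obtain T where T: "bounded_linear T" "\<And>h. h \<in> H \<Longrightarrow> T h = j h"
    using LP assms(1,2) j(1) unfolding LP_space_def by blast
  obtain A where A: "bounded_linear A" "\<And>z. z \<in> M \<Longrightarrow> A z = inv_into H j z"
    using sobczyk[OF sep M j_inv] by blast
  interpret A: bounded_linear A by (rule A(1))
  have Aj: "A (j h) = h" if "h \<in> H" for h
    using A(2)[of "j h"] that j(2) by (simp add: M_def)
  obtain K where K: "\<And>v. norm (A v) \<le> norm v * K" "0 < K" using A.pos_bounded by blast
  have A_dist: "infdist (A v) H \<le> K * infdist v M" for v
  proof -
    have "infdist (A v) H / K \<le> infdist v M"
    proof (rule infdist_greatest[OF M])
      fix z assume "z \<in> M"
      then have "A z \<in> H" using Aj by (auto simp: M_def)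
      then have "infdist (A v) H \<le> norm (A v - A z)" by (rule infdist_le_norm_diff)
      also have "\<dots> \<le> norm (v - z) * K" using K(1)[of "v - z"] by (simp add: A.diff)
      finally show "infdist (A v) H / K \<le> norm (v - z)" using K(2) by (simp add: field_simps)
    qed
    then show ?thesis using K(2) by (simp add: field_simps)
  qed
  obtain p where p: "bounded_linear p" "\<And>x. x - p x \<in> H" "\<And>h. h \<in> H \<Longrightarrow> p h = 0"
  proof (rule complemented_if_small_on_tails[OF assms(1,2) bounded_linear_compose[OF A(1) T(1)]])
    show "A (T h) = h" if "h \<in> H" for h using that by (simp add: T(2) Aj)
    fix e :: real assume "0 < e"
    then obtain N where N: "\<And>x. infdist (T (c0_tail N x)) M \<le> e / K * norm x"
      using schur_quotient_small_on_tails[OF M schur T(1), of "e / K"] K(2) by auto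
    have "infdist (A (T (c0_tail N x))) H \<le> e * norm x" for x
    proof -
      have "infdist (A (T (c0_tail N x))) H \<le> K * (e / K * norm x)"
        using A_dist N K(2) by (meson mult_left_mono less_imp_le order_trans)
      then show ?thesis using K(2) by simp
    qed
    then show "\<exists>N. \<forall>x. infdist (A (T (c0_tail N x))) H \<le> e * norm x" by blast
  qed blast
  show False
    using complemented_quotient_dichotomy[OF assms(1) p] assms(3,4) by blast
qed

end
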